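(* There is an absolute constant $C>0$ such that for all integers $n,r$ with $2\leq r\leq \log n$, \[ n!\,\nu(n,r)=\frac{1}{\sqrt r}\, n^{n(1-1/r)}\exp\bigg\{\sum_{N=0}^r d_{rN}\, n^{(r-N)/r}\bigg\}\,(1+\varepsilon_{n,r}),\qquad |\varepsilon_{n,r}|\leq C n^{-1/r}, \] where \[ d_{r0}=-1+\frac1r,\qquad d_{rr}=-\frac1r\sum_{j=2}^r\frac1j, \] and, for $1\leq N\leq r-1$, \[ d_{rN}=\frac{\Gamma(N+N/r)}{(r-N)\,\Gamma(N+1)\,\Gamma(1+N/r)}. \]
   Context: $\Gamma$ is the Euler gamma function and $\log$ is the natural logarithm. For integers $1\leq r\leq n$, $\nu(n,r)$ denotes the probability that a permutation chosen uniformly at random from the symmetric group on $n$ letters has only cycles of length at most $r$; thus $n!\,\nu(n,r)$ is the number of permutations of $n$ letters all of whose cycles have length at most $r$. *)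

theory Defs
  imports "HOL-Probability.Probability" "HOL-Combinatorics.Orbits"
begin

text \<open>
  The symmetric group on \<open>n\<close> letters is \<open>{p. p permutes {1..n}}\<close>. For a permutation \<open>p\<close> of a finite
  set, \<open>orbit p x\<close> is the support of the cycle of \<open>p\<close> through \<open>x\<close>, so its cardinality is the length
  of that cycle; a fixed point is a cycle of length \<open>1\<close>.
\<close>

definition nu :: "nat \<Rightarrow> nat \<Rightarrow> real" where
  "nu n r = measure_pmf.prob (pmf_of_set {p. p permutes {1..n}})
              {p. \<forall>x\<in>{1..n}. card (orbit p x) \<le> r}"

text \<open>Only \<open>2 \<le> r\<close> and \<open>N \<le> r\<close> are meaningful.\<close>

definition d :: "nat \<Rightarrow> nat \<Rightarrow> real" where
  "d r N =
     (if N = 0 then - 1 + 1 / real r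
      else if N = r then - (1 / real r) * (\<Sum>j=2..r. 1 / real j)
      else Gamma (real N + real N / real r)
             / ((real r - real N) * Gamma (real N + 1) * Gamma (1 + real N / real r)))"

end

theory Submission
  imports Defs "HOL-Complex_Analysis.Complex_Analysis"
begin

text \<open>
  The numbers \<open>nu n r\<close> are the Taylor coefficients of \<open>exp (P z)\<close> with \<open>P z = (\<Sum>j=1..r. z ^ j / j)\<close>, and
  Cauchy's formula is applied on the circle of radius \<open>x = 1 / w\<close>, where \<open>w\<close> solves
  \<open>n w\<^sup>r = 1 / (1 - w)\<close>. This \<open>x\<close> is not the exact saddle point: \<open>x P' x\<close> differs from \<open>n\<close> by
  \<open>1 / (1 - w) \<le> 3\<close>, which costs only a relative error \<open>O(n\<^sup>-\<^sup>1\<^sup>/\<^sup>2)\<close>, but with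
  \<open>t = n\<^sup>-\<^sup>1\<^sup>/\<^sup>r\<close> it makes \<open>t = w (1 - w)\<^sup>1\<^sup>/\<^sup>r\<close>, so that Lagrange inversion gives \<open>ln (w / t)\<close> as a power series
  in \<open>t\<close> with explicit nonnegative coefficients. The exponent \<open>t\<^sup>r (P x - n ln x)\<close>, up to elementary terms, is then
  a power series in \<open>t\<close> whose coefficients below \<open>t\<^sup>r\<close> are the \<open>d r N\<close>; the coefficients of \<open>t\<^sup>r\<^sup>+\<^sup>m\<close>
  are \<open>O((13/5)\<^sup>m)\<close> uniformly in \<open>r\<close>, and \<open>t \<le> 1/e < 5/13\<close>. Stirling's formula is the case \<open>r = 1\<close>
  of the same circle estimate.
\<close>

text \<open>The coefficients come from differentiating the exponent in \<open>n\<close>. At an exact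
  saddle point only the explicit \<open>n\<close> contributes, so the derivative is
  \<open>ln w = ln t + ln (w / t)\<close>, and integrating back divides the coefficient of
  \<open>t^N\<close> by \<open>1 - N/r\<close>. This loses the coefficient of \<open>t^r\<close>,
  because \<open>n * t^r\<close> is constant; it is computed separately and produces the harmonic
  sum in \<open>d r r\<close>. The radius used is not exactly critical, and subtracting
  \<open>(r + 1) * ln (w / t)\<close> in \<open>exponent_fps\<close> compensates for that at a cost
  of \<open>O(t)\<close>.

  The obstacle is uniformity in \<open>r\<close>. The hypothesis \<open>r <= log n\<close> says that
  \<open>t <= 1/e\<close>. The series in \<open>t\<close> become singular where
  \<open>w * (1 - w) powr (1/r)\<close> is maximal, at \<open>w = r/(r+1)\<close>. The corresponding
  \<open>t\<close> is smallest for \<open>r = 2\<close>, where it is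
  \<open>2 / (3 * sqrt 3) = 0.3849\<close>; the radius \<open>5/13 = 0.3846\<close> lies just below
  it and above \<open>1/e = 0.3679\<close>.\<close>

subsection \<open>Lagrange inversion\<close>

text \<open>The series of \<open>(1 - X) powr (- c)\<close>.\<close>
definition geom_pow :: "'a::field_char_0 \<Rightarrow> 'a fps" where
  "geom_pow c = Abs_fps (\<lambda>n. pochhammer c n / fact n)"

lemma geom_pow_nth [simp]: "fps_nth (geom_pow c) n = pochhammer c n / fact n"
  by (simp add: geom_pow_def)

lemma geom_pow_0 [simp]: "geom_pow 0 = 1"
  by (rule fps_ext) (auto simp: pochhammer_0_left)

lemma geom_pow_minus_1: "geom_pow (-1) = 1 - fps_X"
proof (rule fps_ext)
  fix n :: nat
  show "fps_nth (geom_pow (-1)) n = fps_nth (1 - fps_X :: 'a fps) n"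
  proof (cases "n \<le> 1")
    case True
    then consider "n = 0" | "n = 1" by linarith
    then show ?thesis by cases auto
  next
    case False
    then obtain m where "n = Suc (Suc m)"
      by (metis One_nat_def not0_implies_Suc not_less_eq_eq zero_le)
    then show ?thesis by (simp add: pochhammer_rec)
  qed
qed

lemma geom_pow_mult: "geom_pow c * geom_pow e = geom_pow (c + e)"
proof (rule fps_ext)
  fix n
  have "fps_nth (geom_pow c * geom_pow e) n =
    (\<Sum>k\<le>n. pochhammer c k / fact k * (pochhammer e (n - k) / fact (n - k)))"
    by (simp add: fps_mult_nth atLeast0AtMost)
  also have "\<dots> = (\<Sum>k\<le>n. of_nat (n choose k) * pochhammer c k * pochhammer e (n - k)) / fact n"
    unfolding sum_divide_distrib
    by (rule sum.cong) (auto simp: binomial_fact field_simps)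
  also have "\<dots> = fps_nth (geom_pow (c + e)) n"
    by (simp add: pochhammer_binomial_sum)
  finally show "fps_nth (geom_pow c * geom_pow e) n = fps_nth (geom_pow (c + e)) n" .
qed

lemma fps_deriv_geom_pow: "fps_deriv (geom_pow c) = fps_const c * geom_pow (c + 1)"
  by (rule fps_ext) (simp add: pochhammer_rec field_simps del: of_nat_Suc)

lemma geom_pow_power: "geom_pow c ^ n = geom_pow (of_nat n * c)"
  by (induction n) (auto simp: geom_pow_mult algebra_simps)

text \<open>The series of \<open>t = w * (1 - w) powr a\<close> in \<open>w\<close>, used with \<open>a = 1 / r\<close>; \<open>log_saddle_fps\<close> below is that of \<open>ln (w / t)\<close> in \<open>t\<close>.\<close>
definition saddle_fps :: "'a::field_char_0 \<Rightarrow> 'a fps" where "saddle_fps a = fps_X * geom_pow (-a)"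
definition saddle_inv_fps :: "'a::field_char_0 \<Rightarrow> 'a fps" where "saddle_inv_fps a = fps_inv (saddle_fps a)"

lemma saddle_fps_0 [simp]: "fps_nth (saddle_fps a) 0 = 0" and saddle_fps_1 [simp]: "fps_nth (saddle_fps a) (Suc 0) = 1"
  by (auto simp: saddle_fps_def)

lemma saddle_fps_saddle_inv_fps: "saddle_fps a oo saddle_inv_fps a = fps_X" and saddle_inv_fps_saddle_fps: "saddle_inv_fps a oo saddle_fps a = fps_X"
  by (auto simp: saddle_inv_fps_def intro!: fps_inv fps_inv_right)

lemma saddle_inv_fps_0 [simp]: "fps_nth (saddle_inv_fps a) 0 = 0"
  by (simp add: saddle_inv_fps_def fps_inv_def)

text \<open>The residue of \<open>t\<^sup>i\<^sup>-\<^sup>N\<^sup>-\<^sup>1 dt\<close> in the variable \<open>w\<close>, with the pole removed by a factor \<open>w\<^sup>N\<^sup>+\<^sup>1\<close>.\<close>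
lemma residue_power_saddle_fps:
  fixes a :: "'a::field_char_0"
  assumes "i \<le> N" "N > 0"
  shows "fps_nth (saddle_fps a ^ i * fps_deriv (saddle_fps a) * geom_pow (a * of_nat (Suc N))) N = (if i = N then 1 else 0)"
proof -
  define k where "k = N - i"
  have N: "N = i + k" using assms by (simp add: k_def)
  define K where "K = of_nat k * a"
  have b: "geom_pow (a * of_nat (Suc N)) = geom_pow (of_nat i * a) * (geom_pow (K + a))"
    by (simp add: geom_pow_mult K_def N algebra_simps)
  have c: "geom_pow (- (a * of_nat i)) * geom_pow (of_nat i * a) = 1"
    by (simp add: geom_pow_mult algebra_simps)
  have "saddle_fps a ^ i * fps_deriv (saddle_fps a) * geom_pow (a * of_nat (Suc N)) =
     fps_X ^ i * (fps_deriv (saddle_fps a) * geom_pow (K + a)) * (geom_pow (- (a * of_nat i)) * geom_pow (of_nat i * a))"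
    unfolding b saddle_fps_def power_mult_distrib geom_pow_power by (simp add: algebra_simps)
  also have "\<dots> = fps_X ^ i * (fps_deriv (saddle_fps a) * geom_pow (K + a))" unfolding c by simp
  finally have 0: "saddle_fps a ^ i * fps_deriv (saddle_fps a) * geom_pow (a * of_nat (Suc N)) =
     fps_X ^ i * (fps_deriv (saddle_fps a) * geom_pow (K + a))" .
  have 1: "fps_nth (saddle_fps a ^ i * fps_deriv (saddle_fps a) * geom_pow (a * of_nat (Suc N))) N
     = fps_nth (fps_deriv (saddle_fps a) * geom_pow (K + a)) k"
    unfolding 0 fps_X_power_mult_nth by (simp add: N)
  have "fps_deriv (saddle_fps a) * geom_pow (K + a) = geom_pow (-a) * geom_pow (K + a)
     - fps_X * fps_const a * (geom_pow (1 - a) * geom_pow (K + a))"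
    by (simp add: saddle_fps_def fps_deriv_geom_pow algebra_simps fps_const_neg [symmetric] del: fps_const_neg)
  also have "\<dots> = geom_pow K - fps_X * fps_const a * geom_pow (K + 1)"
    unfolding geom_pow_mult by (simp add: algebra_simps)
  finally have 2: "fps_deriv (saddle_fps a) * geom_pow (K + a) = geom_pow K - fps_X * (fps_const a * geom_pow (K + 1))"
    by (simp add: algebra_simps)
  show ?thesis
  proof (cases k)
    case 0
    then show ?thesis unfolding 1 2 by (simp add: N)
  next
    case (Suc m)
    \<comment> \<open>Here \<open>K = Suc m * a\<close>, and its factor \<open>Suc m\<close> cancels
      against the factorial: the differential of a nonconstant power of \<open>t\<close> has no
      residue.\<close>
    have "pochhammer K (Suc m) / fact (Suc m) = a * pochhammer (K+1) m / fact m"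
      unfolding pochhammer_rec[of K] by (simp add: K_def Suc del: of_nat_Suc)
    then show ?thesis unfolding 1 2 by (simp add: N Suc)
  qed
qed

text \<open>Coefficient \<open>N\<close> of \<open>fps_deriv g\<close> is the residue of
  \<open>g'(t) t^(-N-1) dt\<close>; the substitution \<open>t = saddle_fps a\<close> turns
  \<open>g'(t) dt\<close> into \<open>F'(w) dw\<close>. With the composite \<open>F\<close> as a
  parameter, one lemma serves both \<open>log_saddle_fps\<close> and its exponentials.\<close>

lemma lagrange_saddle_fps:
  fixes a :: "'a::field_char_0"
  assumes "g oo saddle_fps a = F"
  shows "of_nat (Suc N) * fps_nth g (Suc N) = fps_nth (fps_deriv F * geom_pow (a * of_nat (Suc N))) N"
proof -
  have "fps_deriv F = (fps_deriv g oo saddle_fps a) * fps_deriv (saddle_fps a)"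
    using assms fps_compose_deriv[of "saddle_fps a" g] by simp
  then have *: "fps_deriv F * geom_pow (a * of_nat (Suc N)) =
     (fps_deriv g oo saddle_fps a) * (fps_deriv (saddle_fps a) * geom_pow (a * of_nat (Suc N)))" (is "_ = _ * ?B")
    by (simp add: algebra_simps)
  have z: "fps_nth (saddle_fps a ^ i) j = 0" if "j < i" for i j
    using that by (simp add: saddle_fps_def power_mult_distrib fps_X_power_mult_nth)
  have "fps_nth ((fps_deriv g oo saddle_fps a) * ?B) N = (\<Sum>j\<le>N. (\<Sum>i\<le>j. fps_nth (fps_deriv g) i * fps_nth (saddle_fps a ^ i) j) * fps_nth ?B (N - j))"
    by (simp add: fps_mult_nth fps_compose_nth atLeast0AtMost)
  \<comment> \<open>\<open>saddle_fps a ^ i\<close> starts at degree \<open>i\<close>, so the inner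
    range can be made independent of \<open>j\<close>, after which the sums can be
    exchanged.\<close>
  also have "\<dots> = (\<Sum>j\<le>N. (\<Sum>i\<le>N. fps_nth (fps_deriv g) i * fps_nth (saddle_fps a ^ i) j) * fps_nth ?B (N - j))"
    by (intro sum.cong refl arg_cong2[of _ _ _ _ "(*)"] sum.mono_neutral_left) (auto simp: z)
  also have "\<dots> = (\<Sum>i\<le>N. fps_nth (fps_deriv g) i * fps_nth (saddle_fps a ^ i * ?B) N)"
    unfolding sum_distrib_right fps_mult_nth[of "saddle_fps a ^ _"] sum_distrib_left atLeast0AtMost
    by (subst sum.swap) (simp add: algebra_simps)
  also have "\<dots> = (\<Sum>i\<le>N. fps_nth (fps_deriv g) i * (if i = N then 1 else 0))"
  proof (intro sum.cong refl arg_cong2[of _ _ _ _ "(*)"])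
    fix i assume i: "i \<in> {..N}"
    show "fps_nth (saddle_fps a ^ i * ?B) N = (if i = N then 1 else 0)"
    proof (cases "N = 0")
      case True
      then show ?thesis using i by (simp add: saddle_fps_def)
    next
      case False
      then show ?thesis using residue_power_saddle_fps[of i N a] i by (simp add: mult.assoc)
    qed
  qed
  also have "\<dots> = fps_nth (fps_deriv g) N"
    by (simp add: if_distrib[of "\<lambda>x. _ * x"] del: fps_deriv_nth cong: if_cong)
  finally show ?thesis unfolding * by simp
qed

definition log_fps :: "'a::field_char_0 \<Rightarrow> 'a fps" where
  "log_fps a = fps_const a * fps_integral0 (geom_pow 1)"
definition log_saddle_fps :: "'a::field_char_0 \<Rightarrow> 'a fps" where "log_saddle_fps a = log_fps a oo saddle_inv_fps a"

lemma log_fps_0 [simp]: "fps_nth (log_fps a) 0 = 0" by (simp add: log_fps_def)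
lemma log_saddle_fps_0 [simp]: "fps_nth (log_saddle_fps a) 0 = 0" by (simp add: log_saddle_fps_def fps_compose_nth)

lemma fps_deriv_log_fps: "fps_deriv (log_fps a) = fps_const a * geom_pow 1"
  by (simp add: log_fps_def fps_deriv_fps_integral)

lemma oo_saddle_inv_fps_saddle_fps: "F oo saddle_inv_fps a oo saddle_fps a = F"
  by (subst fps_compose_assoc [symmetric]) (auto simp: saddle_inv_fps_saddle_fps)

text \<open>The derivative of \<open>log_fps a\<close> is again a \<open>geom_pow\<close>, so
  Lagrange inversion asks for one coefficient of a single power of \<open>1 - X\<close>. For
  \<open>a > 0\<close> it is nonnegative, which the later bounds exploit.\<close>

lemma log_saddle_fps_nth: "fps_nth (log_saddle_fps a) (Suc N) = a * pochhammer (1 + a * of_nat (Suc N)) N / fact (Suc N)"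
proof -
  have "of_nat (Suc N) * fps_nth (log_saddle_fps a) (Suc N)
     = fps_nth (fps_const a * (geom_pow 1 * geom_pow (a * of_nat (Suc N)))) N"
    using lagrange_saddle_fps[of "log_saddle_fps a" a "log_fps a" N] unfolding log_saddle_fps_def fps_deriv_log_fps oo_saddle_inv_fps_saddle_fps
    by (simp add: mult.assoc)
  also have "\<dots> = a * pochhammer (1 + a * of_nat (Suc N)) N / fact N"
    unfolding geom_pow_mult by simp
  finally show ?thesis by (simp add: field_simps del: of_nat_Suc)
qed

lemma fps_exp_oo_log_fps: "fps_exp c oo log_fps a = geom_pow (c * a)"
proof -
  define k where "k = c * a"
  define F where "F = fps_exp c oo log_fps a"
  have F': "fps_deriv F = fps_const k * (geom_pow 1 * F)"
  proof -
    have "fps_deriv F = (fps_const c * fps_exp c oo log_fps a) * (fps_const a * geom_pow 1)"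
      unfolding F_def by (simp add: fps_compose_deriv fps_deriv_log_fps)
    also have "fps_const c * fps_exp c oo log_fps a = fps_const c * F"
      unfolding F_def by (simp add: fps_compose_mult_distrib)
    also have "\<dots> * (fps_const a * geom_pow 1) = fps_const c * fps_const a * (geom_pow 1 * F)"
      by (simp only: mult_ac)
    finally show ?thesis by (simp add: k_def)
  qed
  \<comment> \<open>Integrating factor: the derivative of this product vanishes, so the product
    equals its constant term.\<close>
  have "fps_deriv (F * geom_pow (- k)) = fps_const k * F * (geom_pow 1 * geom_pow (-k)) + fps_const (-k) * F * geom_pow (-k + 1)"
    by (simp only: F' fps_deriv_geom_pow fps_deriv_mult mult_ac add_ac)
  also have "geom_pow 1 * geom_pow (-k) = geom_pow (-k + 1)"
    by (simp only: geom_pow_mult add.commute)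
  finally have "fps_deriv (F * geom_pow (-k)) = (fps_const k + fps_const (-k)) * (F * geom_pow (-k + 1))"
    by (simp only: ring_distribs mult_ac)
  also have "\<dots> = 0" by simp
  finally have "F * geom_pow (- k) = fps_const (fps_nth (F * geom_pow (- k)) 0)"
    using fps_deriv_eq_0_iff by blast
  also have "\<dots> = 1" by (simp add: F_def fps_compose_nth)
  finally have *: "F * geom_pow (- k) = 1" .
  have "F = F * (geom_pow (-k) * geom_pow k)" by (simp add: geom_pow_mult)
  also have "\<dots> = geom_pow k" using * by (simp add: mult.assoc [symmetric])
  finally show ?thesis by (simp add: F_def k_def)
qed

lemma fps_exp_oo_log_saddle_fps: "fps_exp c oo log_saddle_fps a = geom_pow (c * a) oo saddle_inv_fps a"
  unfolding log_saddle_fps_def by (subst fps_compose_assoc) (auto simp: fps_exp_oo_log_fps)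

lemma fps_exp_minus_inverse_oo_log_saddle_fps: "a \<noteq> 0 \<Longrightarrow> fps_exp (- inverse a) oo log_saddle_fps a = 1 - saddle_inv_fps a"
  by (simp add: fps_exp_oo_log_saddle_fps geom_pow_minus_1 fps_compose_sub_distrib)

lemma saddle_inv_fps_mult_exp_log_saddle_fps: "saddle_inv_fps a * (fps_exp (-1) oo log_saddle_fps a) = fps_X"
proof -
  have "saddle_inv_fps a * (fps_exp (-1) oo log_saddle_fps a) = (fps_X * geom_pow (-a)) oo saddle_inv_fps a"
    by (simp add: fps_exp_oo_log_saddle_fps fps_compose_mult_distrib fps_X_fps_compose_startby0)
  then show ?thesis using saddle_fps_saddle_inv_fps[of a] by (simp add: saddle_fps_def)
qed

lemma fps_exp_add_oo: "fps_nth L 0 = 0 \<Longrightarrow> fps_exp (c + e) oo L = (fps_exp c oo L) * (fps_exp e oo L)"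
  for L :: "'a::field_char_0 fps"
  by (simp add: fps_exp_add_mult fps_compose_mult_distrib)

lemma fps_exp_power_oo: "fps_nth L 0 = 0 \<Longrightarrow> fps_exp (of_nat n * c) oo L = (fps_exp c oo L) ^ n"
  for L :: "'a::field_char_0 fps"
  by (simp add: fps_exp_power_mult fps_compose_power)

lemma saddle_inv_fps_eq: "saddle_inv_fps a = fps_X * (fps_exp 1 oo log_saddle_fps a)"
proof -
  have "saddle_inv_fps a = saddle_inv_fps a * ((fps_exp (-1) oo log_saddle_fps a) * (fps_exp 1 oo log_saddle_fps a))"
    by (simp flip: fps_exp_add_oo)
  then show ?thesis by (simp only: mult.assoc [symmetric] saddle_inv_fps_mult_exp_log_saddle_fps)
qed

text \<open>The power of \<open>1 - X\<close> supplied by Lagrange inversion cancels that of the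
  exponential down to \<open>geom_pow 1\<close>, whose coefficients are all 1. The
  \<open>j\<close>-th summand of \<open>exponent_fps\<close> carries \<open>X^(r - j)\<close>, so
  this diagonal coefficient is what it contributes at \<open>X^r\<close>: the source of the harmonic
  sum.\<close>

lemma fps_nth_exp_oo_log_saddle_fps_diag:
  assumes "j > 0"
  shows "fps_nth (fps_exp (- of_nat j) oo log_saddle_fps a) j = - a"
proof -
  obtain m where m: "j = Suc m" using assms by (cases j) auto
  define g where "g = fps_exp (- of_nat j) oo log_saddle_fps a"
  have "g oo saddle_fps a = geom_pow (- of_nat j * a)"
    unfolding g_def fps_exp_oo_log_saddle_fps by (rule oo_saddle_inv_fps_saddle_fps)
  from lagrange_saddle_fps[OF this, of m]
  have "of_nat j * fps_nth g j =
    fps_nth (fps_const (- of_nat j * a) * (geom_pow (- of_nat j * a + 1) * geom_pow (a * of_nat j))) m"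
    by (simp only: m fps_deriv_geom_pow mult.assoc)
  also have "geom_pow (- of_nat j * a + 1) * geom_pow (a * of_nat j) = geom_pow 1"
    by (simp add: geom_pow_mult algebra_simps)
  finally have "of_nat j * fps_nth g j = of_nat j * (- a)" by (simp flip: pochhammer_fact)
  then have "fps_nth g j = - a" using assms by (metis mult_left_cancel of_nat_eq_0_iff not_gr_zero)
  then show ?thesis by (simp add: g_def)
qed

section \<open>The exponent as a formal power series and its differential equation\<close>

context
  fixes r :: nat and a :: "'a::field_char_0"
  assumes r: "r > 0" and a: "a = inverse (of_nat r)"
begin

text \<open>\<open>t\<^sup>r\<close> times the exponent. The last summand is chosen so that the coefficient of \<open>X\<^sup>r\<close>, which
  the differential equation \<open>exponent_fps_ode\<close> leaves free, vanishes.\<close>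
definition exponent_fps :: "'a fps" where
  "exponent_fps = (\<Sum>j=1..r. fps_const (1 / of_nat j) * fps_X ^ (r - j) * (fps_exp (- of_nat j) oo log_saddle_fps a))
     - fps_const (of_nat r + 1) * fps_X ^ r * log_saddle_fps a + log_saddle_fps a - fps_const a
     + fps_const (a * (\<Sum>j=2..r. 1 / of_nat j)) * fps_X ^ r"

lemma exp_r_oo_log_saddle_fps: "fps_exp (- of_nat r) oo log_saddle_fps a = 1 - saddle_inv_fps a"
  using fps_exp_minus_inverse_oo_log_saddle_fps[of a] r by (simp add: a)

text \<open>Write \<open>L\<close> for \<open>log_saddle_fps a\<close>. By
  \<open>w = X * exp L\<close> and \<open>1 - w = exp (- r * L)\<close> each summand is
  \<open>(1 - w) * w^(r - j)\<close>, and the geometric sum telescopes. The left side is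
  \<open>t^r * x * P' x\<close>.\<close>

lemma sum_exp_oo_log_saddle_fps:
  "(\<Sum>j=1..r. fps_X ^ (r - j) * (fps_exp (- of_nat j) oo log_saddle_fps a)) = 1 - fps_X ^ r * (fps_exp (of_nat r) oo log_saddle_fps a)"
proof -
  have "(\<Sum>j=1..r. fps_X ^ (r - j) * (fps_exp (- of_nat j) oo log_saddle_fps a)) =
    (\<Sum>j=1..r. (fps_exp (- of_nat r) oo log_saddle_fps a) * saddle_inv_fps a ^ (r - j))"
  proof (intro sum.cong refl)
    fix j assume j: "j \<in> {1..r}"
    have "saddle_inv_fps a ^ (r - j) = fps_X ^ (r - j) * (fps_exp (of_nat (r - j)) oo log_saddle_fps a)"
      unfolding saddle_inv_fps_eq power_mult_distrib using fps_exp_power_oo[of "log_saddle_fps a" "r - j" 1] by simp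
    then have "(fps_exp (- of_nat r) oo log_saddle_fps a) * saddle_inv_fps a ^ (r - j) =
      fps_X ^ (r - j) * ((fps_exp (- of_nat r) oo log_saddle_fps a) * (fps_exp (of_nat (r - j)) oo log_saddle_fps a))"
      by (simp only: mult_ac)
    also have "\<dots> = fps_X ^ (r - j) * (fps_exp (- of_nat j) oo log_saddle_fps a)"
      using j by (simp add: of_nat_diff flip: fps_exp_add_oo)
    finally show "fps_X ^ (r - j) * (fps_exp (- of_nat j) oo log_saddle_fps a) = (fps_exp (- of_nat r) oo log_saddle_fps a) * saddle_inv_fps a ^ (r - j)" ..
  qed
  also have "\<dots> = (1 - saddle_inv_fps a) * (\<Sum>j=1..r. saddle_inv_fps a ^ (r - j))"
    unfolding exp_r_oo_log_saddle_fps by (simp only: sum_distrib_left)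
  also have "(\<Sum>j=1..r. saddle_inv_fps a ^ (r - j)) = (\<Sum>i<r. saddle_inv_fps a ^ i)"
    by (rule sum.reindex_bij_witness[of _ "\<lambda>i. r - i" "\<lambda>j. r - j"]) auto
  also have "(1 - saddle_inv_fps a) * \<dots> = 1 - saddle_inv_fps a ^ r" by (simp add: one_diff_power_eq)
  also have "saddle_inv_fps a ^ r = fps_X ^ r * (fps_exp (of_nat r) oo log_saddle_fps a)"
    unfolding saddle_inv_fps_eq power_mult_distrib using fps_exp_power_oo[of "log_saddle_fps a" r 1] by simp
  finally show ?thesis .
qed


lemma X_deriv_X_power: "fps_X * fps_deriv (fps_X ^ k) = fps_const (of_nat k) * (fps_X ^ k :: 'b::field_char_0 fps)"
proof (rule fps_ext)
  fix n show "fps_nth (fps_X * fps_deriv (fps_X ^ k)) n = fps_nth (fps_const (of_nat k) * (fps_X ^ k :: 'b fps)) n"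
    by (cases n) (auto simp: fps_X_power_nth)
qed

lemma X_deriv_exp_oo:
  "fps_X * fps_deriv (fps_X ^ k * (fps_exp c oo log_saddle_fps a)) =
     (fps_const (of_nat k) + fps_const c * (fps_X * fps_deriv (log_saddle_fps a))) * (fps_X ^ k * (fps_exp c oo log_saddle_fps a))"
proof -
  define L where "L = fps_deriv (log_saddle_fps a)"
  define E where "E = fps_exp c oo log_saddle_fps a"
  have 1: "fps_deriv E = fps_const c * E * L"
    unfolding E_def L_def by (simp add: fps_compose_deriv fps_compose_mult_distrib)
  have "fps_X * fps_deriv (fps_X ^ k * E) = (fps_X * fps_deriv (fps_X ^ k)) * E + fps_X * fps_X ^ k * fps_deriv E"
    by (simp add: algebra_simps)
  also have "\<dots> = (fps_const (of_nat k) + fps_const c * (fps_X * L)) * (fps_X ^ k * E)"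
    unfolding 1 X_deriv_X_power by (simp only: ring_distribs mult_ac)
  finally show ?thesis unfolding E_def L_def .
qed

text \<open>\<open>X * d/dX\<close> is applied to \<open>w\<close> twice, through
  \<open>w = X * exp L\<close> and through \<open>1 - w = exp (- r * L)\<close>. Equating the
  results and eliminating \<open>w\<close> by \<open>E * (1 - W) = 1\<close> gives the
  relation.\<close>

lemma log_saddle_fps_ode:
  "(fps_exp (of_nat r) oo log_saddle_fps a) * (1 + fps_X * fps_deriv (log_saddle_fps a)) =
     1 + fps_const (of_nat r + 1) * (fps_X * fps_deriv (log_saddle_fps a))"
proof -
  define E where "E = fps_exp (of_nat r) oo log_saddle_fps a"
  define D where "D = fps_X * fps_deriv (log_saddle_fps a)"
  define W where "W = saddle_inv_fps a"
  have EW: "E * (1 - W) = 1"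
    unfolding E_def W_def exp_r_oo_log_saddle_fps [symmetric] by (simp flip: fps_exp_add_oo)
  have W1: "fps_X * fps_deriv W = W * (1 + D)"
    using X_deriv_exp_oo[of 1 1] by (simp add: W_def saddle_inv_fps_eq D_def algebra_simps)
  have "fps_X * fps_deriv (1 - W) = - fps_const (of_nat r) * D * (1 - W)"
    using X_deriv_exp_oo[of 0 "- of_nat r"] unfolding exp_r_oo_log_saddle_fps W_def [symmetric]
    by (simp add: D_def mult_ac flip: fps_const_neg)
  moreover have "fps_X * fps_deriv (1 - W) = - (fps_X * fps_deriv W)" by simp
  ultimately have W2: "W * (1 + D) = fps_const (of_nat r) * D * (1 - W)"
    unfolding W1 by (metis minus_minus minus_mult_left)
  have EW': "E * W = E - 1" using EW by (simp add: algebra_simps)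
  have "E * W * (1 + D) = fps_const (of_nat r) * D * (E * (1 - W))"
    using W2 by (metis mult.assoc mult.commute)
  then have "(E - 1) * (1 + D) = fps_const (of_nat r) * D" unfolding EW EW' by simp
  then have "E * (1 + D) = 1 + (fps_const (of_nat r) + 1) * D" by (simp add: algebra_simps)
  then show ?thesis by (simp add: E_def D_def flip: fps_const_add)
qed

text \<open>With \<open>n = X^(-r)\<close>, the operator on the left takes \<open>F\<close> to the
  derivative of \<open>n * F\<close> in \<open>n\<close>, so it differentiates the unscaled
  exponent. The contributions of the moving radius are evaluated by
  \<open>sum_exp_oo_log_saddle_fps\<close>, and \<open>log_saddle_fps_ode\<close> cancels them, up
  to a multiple of \<open>X^r\<close>, against the term with factor \<open>r + 1\<close>.\<close>

lemma exponent_fps_ode: "exponent_fps - fps_const a * (fps_X * fps_deriv exponent_fps) = log_saddle_fps a - fps_const a * fps_X ^ r"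
proof -
  define E where "E = fps_exp (of_nat r) oo log_saddle_fps a"
  define D where "D = fps_X * fps_deriv (log_saddle_fps a)"
  define Y where "Y = (\<lambda>j. fps_X ^ (r - j) * (fps_exp (- of_nat j) oo log_saddle_fps a))"
  define \<theta> where "\<theta> = (\<lambda>F::'a fps. F - fps_const a * (fps_X * fps_deriv F))"
  have \<theta>_add: "\<theta> (F + G) = \<theta> F + \<theta> G" and \<theta>_diff: "\<theta> (F - G) = \<theta> F - \<theta> G" for F G
    by (simp_all add: \<theta>_def algebra_simps)
  have \<theta>_const: "\<theta> (fps_const c * F) = fps_const c * \<theta> F" for c F
    by (simp add: \<theta>_def algebra_simps)
  have \<theta>_sum: "\<theta> (\<Sum>j=1..r. F j) = (\<Sum>j=1..r. \<theta> (F j))" for F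
    by (simp add: \<theta>_def fps_deriv_sum sum_distrib_left sum_subtractf)
  have ar: "fps_const a * fps_const (of_nat r) = 1" using r by (simp add: a)
  have X_r: "fps_X * fps_deriv (fps_X ^ r) = fps_const (of_nat r) * (fps_X ^ r :: 'a fps)"
    by (rule X_deriv_X_power)
  \<comment> \<open>The kernel of \<open>\<theta>\<close> contains \<open>X^r\<close>, so the
    multiple of \<open>X^r\<close> in \<open>exponent_fps\<close> is invisible to the
    equation.\<close>
  have \<theta>_X: "\<theta> (fps_X ^ r) = 0"
    unfolding \<theta>_def X_r by (simp only: mult.assoc [symmetric] ar) simp
  have \<theta>_XL: "\<theta> (fps_X ^ r * log_saddle_fps a) = - (fps_const a * (fps_X ^ r * D))"
  proof -
    have "fps_X * fps_deriv (fps_X ^ r * log_saddle_fps a) = (fps_X * fps_deriv (fps_X ^ r)) * log_saddle_fps a + fps_X ^ r * D"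
      by (simp only: fps_deriv_mult ring_distribs mult_ac D_def)
    also have "\<dots> = fps_const (of_nat r) * (fps_X ^ r * log_saddle_fps a) + fps_X ^ r * D"
      by (simp only: X_r mult_ac)
    finally show ?thesis
      unfolding \<theta>_def by (simp only: ring_distribs mult.assoc [symmetric] ar) simp
  qed
  have gen: "y - A * ((R - J + - J * B) * y) = y - (A * R) * y + A * J * ((1 + B) * y)" for y A R J B :: "'a fps"
    by (simp add: algebra_simps)
  have \<theta>_Y: "fps_const (1 / of_nat j) * \<theta> (Y j) = fps_const a * ((1 + D) * Y j)" if j: "j \<in> {1..r}" for j
  proof -
    have "\<theta> (Y j) = Y j - fps_const a * ((fps_const (of_nat (r - j)) + fps_const (- of_nat j) * D) * Y j)"
      unfolding \<theta>_def Y_def X_deriv_exp_oo D_def ..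
    also have "fps_const (of_nat (r - j)) = fps_const (of_nat r) - (fps_const (of_nat j) :: 'a fps)"
      using j by (auto simp: of_nat_diff fps_const_sub)
    also have "Y j - fps_const a * ((fps_const (of_nat r) - fps_const (of_nat j) + fps_const (- of_nat j) * D) * Y j)
      = Y j - (fps_const a * fps_const (of_nat r)) * Y j + fps_const a * fps_const (of_nat j) * ((1 + D) * Y j)"
      unfolding fps_const_neg [symmetric] by (rule gen)
    also have "\<dots> = fps_const (of_nat j) * (fps_const a * ((1 + D) * Y j))"
      unfolding ar by (simp only: mult_ac) simp
    finally have "fps_const (1 / of_nat j) * \<theta> (Y j) = fps_const (1 / of_nat j) * fps_const (of_nat j) * (fps_const a * ((1 + D) * Y j))"
      by (simp only: mult.assoc)
    then show ?thesis using j by simp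
  qed
  have "\<theta> (\<Sum>j=1..r. fps_const (1 / of_nat j) * Y j) = (\<Sum>j=1..r. fps_const a * ((1 + D) * Y j))"
    unfolding \<theta>_sum \<theta>_const by (intro sum.cong refl \<theta>_Y)
  also have "\<dots> = fps_const a * ((1 + D) * (\<Sum>j=1..r. Y j))"
    by (simp only: sum_distrib_left)
  also have "(\<Sum>j=1..r. Y j) = 1 - fps_X ^ r * E"
    unfolding Y_def E_def by (rule sum_exp_oo_log_saddle_fps)
  also have "(1 + D) * (1 - fps_X ^ r * E) = 1 + D - fps_X ^ r * (E * (1 + D))"
    by (simp add: algebra_simps)
  also have "E * (1 + D) = 1 + fps_const (of_nat r + 1) * D"
    unfolding E_def D_def by (rule log_saddle_fps_ode)
  finally have 1: "\<theta> (\<Sum>j=1..r. fps_const (1 / of_nat j) * Y j) =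
     fps_const a * (1 + D - fps_X ^ r * (1 + fps_const (of_nat r + 1) * D))" .
  have "exponent_fps = (\<Sum>j=1..r. fps_const (1 / of_nat j) * Y j) - fps_const (of_nat r + 1) * (fps_X ^ r * log_saddle_fps a) + log_saddle_fps a - fps_const a * 1
     + fps_const (a * (\<Sum>j=2..r. 1 / of_nat j)) * fps_X ^ r"
    unfolding exponent_fps_def Y_def by (simp add: mult.assoc)
  then have "\<theta> exponent_fps = fps_const a * (1 + D - fps_X ^ r * (1 + fps_const (of_nat r + 1) * D))
     + fps_const (of_nat r + 1) * (fps_const a * (fps_X ^ r * D)) + \<theta> (log_saddle_fps a) - fps_const a * \<theta> 1"
    by (simp only: \<theta>_add \<theta>_diff \<theta>_const \<theta>_X \<theta>_XL 1) simp
  also have "\<theta> (log_saddle_fps a) = log_saddle_fps a - fps_const a * D" by (simp add: \<theta>_def D_def)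
  also have "\<theta> 1 = 1" by (simp add: \<theta>_def)
  finally show ?thesis unfolding \<theta>_def by (simp add: algebra_simps del: fps_const_mult)
qed

text \<open>Off \<open>N = r\<close> the differential equation is solved coefficientwise. At
  \<open>N = r\<close> it reads \<open>0 = 0\<close>, so the coefficient is read off the definition:
  the diagonal coefficients give \<open>- a\<close> times the harmonic sum,
  \<open>log_saddle_fps a\<close> gives \<open>a\<close>, and the last summand of
  \<open>exponent_fps\<close> cancels the rest.\<close>

lemma exponent_fps_nth:
  "fps_nth exponent_fps N = (if N = r then 0 else fps_nth (log_saddle_fps a) N / (1 - of_nat N / of_nat r))"
proof (cases "N = r")
  case False
  have "fps_nth (exponent_fps - fps_const a * (fps_X * fps_deriv exponent_fps)) N = fps_nth (log_saddle_fps a - fps_const a * fps_X ^ r) N"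
    unfolding exponent_fps_ode ..
  then have "fps_nth exponent_fps N * (1 - of_nat N / of_nat r) = fps_nth (log_saddle_fps a) N"
    using False r by (cases N) (auto simp: fps_X_power_nth algebra_simps a divide_inverse)
  moreover have "1 - of_nat N / of_nat r \<noteq> (0::'a)" using False r by auto
  ultimately show ?thesis using False by (simp add: field_simps)
next
  case True
  have *: "fps_nth (fps_const (1 / of_nat j) * fps_X ^ (r - j) * (fps_exp (- of_nat j) oo log_saddle_fps a)) r = - a * (1 / of_nat j)"
    if j: "j \<in> {1..r}" for j
    using j fps_nth_exp_oo_log_saddle_fps_diag[of j a] by (simp add: mult.assoc fps_X_power_mult_nth)
  have "fps_nth exponent_fps r = (\<Sum>j=1..r. - a * (1 / of_nat j)) + fps_nth (log_saddle_fps a) r + a * (\<Sum>j=2..r. 1 / of_nat j)"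
    unfolding exponent_fps_def using r * by (simp add: fps_sum_nth mult.assoc fps_X_power_mult_nth)
  also have "(\<Sum>j=1..r. - a * (1 / of_nat j)) = - a * (\<Sum>j=1..r. 1 / of_nat j)"
    by (simp only: sum_distrib_left)
  also have "{1..r} = insert 1 {2..r}" using r by auto
  also have "(\<Sum>j\<in>insert 1 {2..r}. 1 / of_nat j) = 1 + (\<Sum>j=2..r. 1 / of_nat j :: 'a)"
    by (subst sum.insert) auto
  also have "fps_nth (log_saddle_fps a) r = a"
  proof -
    obtain m where m: "r = Suc m" using r by (cases r) auto
    have "1 + a * of_nat (Suc m) = 2" by (simp add: a m del: of_nat_Suc)
    moreover have "pochhammer 2 m = (fact (Suc m) :: 'a)"
      using pochhammer_rec[of "1::'a" m] by (simp flip: pochhammer_fact)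
    ultimately show ?thesis unfolding m log_saddle_fps_nth by (simp del: of_nat_Suc fact_Suc)
  qed
  finally show ?thesis using True by (simp add: algebra_simps)
qed

end

subsection \<open>The saddle point as a function of the scale\<close>

definition log_saddle_coeff :: "nat \<Rightarrow> nat \<Rightarrow> real" where
  "log_saddle_coeff r N = fps_nth (log_saddle_fps (inverse (real r))) N"

text \<open>The series is used over two fields: over the complex numbers formal identities become
  identities of holomorphic functions, over the reals the coefficients have a sign.\<close>

lemma log_saddle_fps_complex_nth: "fps_nth (log_saddle_fps (inverse (of_nat r))) N = complex_of_real (log_saddle_coeff r N)"
proof (cases N)
  case (Suc n)
  have "1 + inverse (of_nat r) * of_nat (Suc n) = complex_of_real (1 + inverse (real r) * real (Suc n))"
    by simp
  then show ?thesis unfolding Suc log_saddle_coeff_def log_saddle_fps_nth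
    by (simp only: pochhammer_of_real of_real_mult of_real_divide of_real_fact of_real_inverse of_real_of_nat_eq)
qed (simp add: log_saddle_coeff_def)

lemma log_saddle_coeff_0 [simp]: "log_saddle_coeff r 0 = 0" by (simp add: log_saddle_coeff_def)

lemma log_saddle_coeff_nonneg: "0 \<le> log_saddle_coeff r N"
  by (cases N) (auto simp: log_saddle_coeff_def log_saddle_fps_nth intro!: mult_nonneg_nonneg divide_nonneg_nonneg pochhammer_nonneg add_pos_nonneg)

text \<open>A coefficient of \<open>(1 - X) powr (- 1 - b)\<close> is a partial sum of those of \<open>(1 - X) powr (- b)\<close>. Bounding the
  latter avoids a factor \<open>1 / (1 - \<rho>)\<close>, of order \<open>r\<close> below, which would destroy uniformity.\<close>
lemma pochhammer_fact_le:
  fixes b \<rho> :: real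
  assumes "0 < b" "0 < \<rho>" "\<rho> < 1"
  shows "pochhammer (1 + b) M / fact M \<le> (1 - \<rho>) powr (- b) / \<rho> ^ M"
proof -
  have "(\<lambda>n. ((-b) gchoose n) * (-\<rho>) ^ n) sums (1 + - \<rho>) powr (- b)"
    by (rule gen_binomial_real) (use assms in auto)
  also have "(\<lambda>n. ((-b) gchoose n) * (-\<rho>) ^ n) = (\<lambda>n. pochhammer b n / fact n * \<rho> ^ n)"
  proof (rule ext)
    fix n
    have "(-1) ^ n * (- \<rho>) ^ n = \<rho> ^ n" by (simp flip: power_mult_distrib)
    then show "((-b) gchoose n) * (-\<rho>) ^ n = pochhammer b n / fact n * \<rho> ^ n"
      unfolding gbinomial_pochhammer by (simp add: mult_ac)
  qed
  finally have s: "(\<lambda>n. pochhammer b n / fact n * \<rho> ^ n) sums (1 - \<rho>) powr (- b)" by simp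
  have "geom_pow (1 + b) = geom_pow 1 * geom_pow b" by (simp add: geom_pow_mult)
  from arg_cong[OF this, of "\<lambda>F. fps_nth F M"]
  have "pochhammer (1 + b) M / fact M = (\<Sum>i\<le>M. pochhammer b (M - i) / fact (M - i))"
    by (simp add: fps_mult_nth atLeast0AtMost flip: pochhammer_fact)
  also have "\<dots> = (\<Sum>i\<le>M. pochhammer b i / fact i)"
    by (rule sum.reindex_bij_witness[of _ "\<lambda>i. M - i" "\<lambda>i. M - i"]) auto
  also have "\<dots> \<le> (\<Sum>i\<le>M. pochhammer b i / fact i * \<rho> ^ i / \<rho> ^ M)"
  proof (rule sum_mono)
    fix i assume i: "i \<in> {..M}"
    have "\<rho> ^ M \<le> \<rho> ^ i" using i assms by (intro power_decreasing) auto
    then have "1 \<le> \<rho> ^ i / \<rho> ^ M" using assms by simp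
    then show "pochhammer b i / fact i \<le> pochhammer b i / fact i * \<rho> ^ i / \<rho> ^ M"
      using assms mult_left_mono[of 1 "\<rho> ^ i / \<rho> ^ M" "pochhammer b i / fact i"]
      by (simp add: pochhammer_nonneg)
  qed
  also have "\<dots> = (\<Sum>i\<le>M. pochhammer b i / fact i * \<rho> ^ i) / \<rho> ^ M" by (simp add: sum_divide_distrib)
  also have "\<dots> \<le> (1 - \<rho>) powr (- b) / \<rho> ^ M"
    using assms by (intro divide_right_mono sum_le_suminf[OF sums_summable[OF s], unfolded sums_unique[OF s, symmetric]]) (auto simp: pochhammer_nonneg)
  finally show ?thesis .
qed

text \<open>The bound \<open>(1 - \<rho>) powr (- b) / \<rho> ^ N\<close> is smallest at
  \<open>\<rho> = r / (r + 1)\<close>, the critical point of \<open>w * (1 - w) powr (1/r)\<close>.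
  The factor \<open>r\<close> on the left is the one that division by \<open>1 - N/r = - m/r\<close>
  will produce.\<close>

lemma log_saddle_coeff_bound:
  assumes r: "r \<ge> 2" and m: "m \<ge> 1"
  shows "real r * log_saddle_coeff r (r + m) \<le> 3 * (13/5) ^ m"
proof -
  define N where "N = r + m"
  define \<rho> where "\<rho> = real r / (real r + 1)"
  have \<rho>: "0 < \<rho>" "\<rho> < 1" "1 - \<rho> = 1 / (real r + 1)" using r by (auto simp: \<rho>_def field_simps)
  obtain M where M: "N = Suc M" using m by (cases N) (auto simp: N_def)
  define b where "b = inverse (real r) * real N"
  have b: "b > 0" "b = 1 + m / r" using r by (auto simp: b_def N_def field_simps)
  have "real r * log_saddle_coeff r N = pochhammer (1 + b) M / fact M / real N"
    using r by (simp add: log_saddle_coeff_def M log_saddle_fps_nth b_def mult_ac)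
  also have "\<dots> \<le> (1 - \<rho>) powr (- b) / \<rho> ^ M / real N"
    by (intro divide_right_mono pochhammer_fact_le b \<rho>) auto
  also have "\<dots> \<le> (1 - \<rho>) powr (- b) / \<rho> ^ N / real N"
    by (intro divide_right_mono divide_left_mono power_decreasing) (use \<rho> in \<open>auto simp: M intro!: mult_pos_pos\<close>)
  also have "(1 - \<rho>) powr (- b) = (real r + 1) powr b"
    unfolding \<rho>(3) by (simp add: powr_divide powr_minus_divide)
  also have "\<dots> = (real r + 1) * ((real r + 1) powr (1 / r)) ^ m"
    unfolding b(2) powr_add by (simp add: powr_power)
  also have "\<rho> ^ N = \<rho> ^ r * \<rho> ^ m" by (simp add: N_def power_add)
  \<comment> \<open>Only the last factor depends exponentially on \<open>m\<close>; the first is at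
    most 1 and \<open>(1 / \<rho>) ^ r\<close> is at most \<open>e\<close>.\<close>
  also have "(real r + 1) * ((real r + 1) powr (1 / r)) ^ m / (\<rho> ^ r * \<rho> ^ m) / N
     = (real r + 1) / N * (1 / \<rho>) ^ r * ((real r + 1) powr (1 / r) / \<rho>) ^ m"
    by (simp add: power_divide)
  also have "\<dots> \<le> 1 * 3 * (13/5) ^ m"
  proof (intro mult_mono power_mono)
    show "(real r + 1) / real N \<le> 1" using m by (simp add: N_def)
    have "(1 / \<rho>) ^ r = (1 + 1 / r) ^ r" using r by (simp add: \<rho>_def field_simps)
    also have "\<dots> \<le> exp 1" using exp_ge_one_plus_x_over_n_power_n[of r 1] r by simp
    finally show "(1 / \<rho>) ^ r \<le> 3" using exp_le by linarith
    \<comment> \<open>Equality holds at \<open>r = 2\<close>, the worst case; the rate is then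
      \<open>3/2 * sqrt 3 = 2.598\<close>, just under \<open>13/5\<close>.\<close>
    have "(real r + 1)\<^sup>2 \<le> 3 ^ r" using r
    proof (induction r rule: dec_induct)
      case (step n)
      have "(real (Suc n) + 1)\<^sup>2 \<le> 3 * (real n + 1)\<^sup>2"
      proof -
        have "(2::real) * 2 \<le> real n * real n" using step by (intro mult_mono) auto
        then show ?thesis by (simp add: power2_eq_square algebra_simps)
      qed
      then show ?case using step by simp
    qed simp
    then have "((real r + 1)\<^sup>2) powr (1 / (2 * real r)) \<le> (3 ^ r) powr (1 / (2 * real r))"
      by (intro powr_mono2) auto
    moreover have "((real r + 1)\<^sup>2) powr (1 / (2 * real r)) = (real r + 1) powr (1 / r)"
      by (simp add: powr_def ln_realpow)
    moreover have "(3 ^ r) powr (1 / (2 * real r)) = sqrt 3"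
      using r by (simp add: powr_def ln_realpow powr_half_sqrt [symmetric])
    ultimately have 1: "(real r + 1) powr (1 / r) \<le> sqrt 3" by simp
    have "1 / \<rho> \<le> 3 / 2" using r unfolding \<rho>_def by (simp add: field_simps)
    then have "(real r + 1) powr (1 / r) * (1 / \<rho>) \<le> sqrt 3 * (3 / 2)"
      using 1 \<rho> by (intro mult_mono) auto
    also have "\<dots> \<le> 13/5"
    proof -
      have "sqrt 3 \<le> 26/15" by (rule real_le_lsqrt) (auto simp: power2_eq_square)
      then show ?thesis by simp
    qed
    finally show "(real r + 1) powr (1 / real r) / \<rho> \<le> 13/5" by simp
  qed (use \<rho> r in auto)
  finally show ?thesis by (simp add: N_def)
qed

text \<open>\<open>46/125\<close> separates \<open>1/e\<close> from \<open>5/13\<close>.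
  \<open>4/27 = (2/3)^2 * (1/3)\<close> is the maximum of \<open>w^2 * (1 - w)\<close> on the unit
  interval, the square of the critical value of \<open>t\<close> for \<open>r = 2\<close>.\<close>

lemma exp_1_bounds: "exp (-1::real) < 46/125" "exp (-2::real) < 4/27"
proof -
  have e: "exp (1::real) > 125/46" using e_approx_32 by (simp add: abs_if split: if_splits)
  then show 1: "exp (-1::real) < 46/125" by (simp add: exp_minus field_simps)
  have "exp (-2::real) = exp (-1) ^ 2" by (simp flip: exp_of_nat_mult)
  also have "\<dots> < (46/125) ^ 2" using 1 by (intro power_strict_mono) auto
  also have "\<dots> < 4/27" by (simp add: power2_eq_square)
  finally show "exp (-2::real) < 4/27" .
qed

lemma fps_conv_radius_log_saddle_fps:
  assumes "r \<ge> 2"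
  shows "fps_conv_radius (log_saddle_fps (inverse (of_nat r)) :: complex fps) \<ge> ereal (5/13)"
  unfolding fps_conv_radius_def
proof (rule conv_radius_geI_ex')
  fix q :: real assume q: "0 < q" "ereal q < ereal (5/13)"
  have q': "q < 5/13" using q(2) by simp
  define K where "K = (3 * (5/13) ^ r :: real)"
  show "summable (\<lambda>n. fps_nth (log_saddle_fps (inverse (of_nat r))) n * complex_of_real q ^ n)"
  proof (rule summable_comparison_test')
    show "summable (\<lambda>n. K * (13/5 * q) ^ n)"
      using q q' by (intro summable_mult summable_geometric) auto
    fix n assume n: "n \<ge> Suc r"
    define m where "m = n - r"
    have m: "n = r + m" "m \<ge> 1" using n by (auto simp: m_def)
    have "log_saddle_coeff r n \<le> real r * log_saddle_coeff r n" using mult_right_mono[of 1 "real r" "log_saddle_coeff r n"] log_saddle_coeff_nonneg assms by simp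
    also have "\<dots> \<le> 3 * (13/5) ^ m" unfolding m(1) by (rule log_saddle_coeff_bound) (use assms m in auto)
    also have "\<dots> = K * (13/5) ^ n" by (simp add: K_def m(1) power_add field_simps)
    finally have "log_saddle_coeff r n * q ^ n \<le> K * (13/5) ^ n * q ^ n" using q by (intro mult_right_mono) auto
    moreover have "norm (fps_nth (log_saddle_fps (inverse (of_nat r))) n * complex_of_real q ^ n) = log_saddle_coeff r n * q ^ n"
      using log_saddle_coeff_nonneg[of r n] q unfolding log_saddle_fps_complex_nth by (simp add: norm_mult norm_power)
    ultimately show "norm (fps_nth (log_saddle_fps (inverse (of_nat r))) n * complex_of_real q ^ n) \<le> K * (13/5 * q) ^ n"
      by (simp only: power_mult_distrib mult.assoc)
  qed
qed

definition log_saddle :: "nat \<Rightarrow> real \<Rightarrow> real" where "log_saddle r t = (\<Sum>N. log_saddle_coeff r N * t ^ N)"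

lemma exp_oo_expansion:
  fixes L :: "complex fps"
  assumes "f has_fps_expansion L" "fps_nth L 0 = 0"
  shows "(\<lambda>z. exp (c * f z)) has_fps_expansion (fps_exp c oo L)"
  using has_fps_expansion_compose[OF has_fps_expansion_exp[of c] assms] by (simp add: o_def)

context
  fixes r :: nat
  assumes r: "r \<ge> 2"
begin

private abbreviation (input) L :: "complex fps" where "L \<equiv> log_saddle_fps (inverse (of_nat r))"

lemma eval_log_saddle_fps_expansion: "eval_fps L has_fps_expansion L"
  by (rule eval_fps_has_fps_expansion, rule less_le_trans[OF _ fps_conv_radius_log_saddle_fps[OF r]]) auto

lemma eval_log_saddle_fps_holomorphic: "eval_fps L holomorphic_on eball 0 (ereal (5/13))"
  by (rule holomorphic_on_eval_fps) (use less_le_trans[OF _ fps_conv_radius_log_saddle_fps[OF r]] in \<open>auto simp: in_eball_iff\<close>)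

lemma eval_log_saddle_fps_real:
  assumes "\<bar>t\<bar> < 5/13"
  shows "eval_fps L (of_real t) = of_real (log_saddle r t)" "summable (\<lambda>N. log_saddle_coeff r N * t ^ N)"
proof -
  have "ereal (norm (complex_of_real t)) < ereal (5/13)"
    using assms by simp
  then have *: "(\<lambda>N. fps_nth L N * of_real t ^ N) sums eval_fps L (of_real t)"
    unfolding eval_fps_def using less_le_trans[OF _ fps_conv_radius_log_saddle_fps[OF r]] by (intro summable_sums summable_fps) blast
  then have **: "(\<lambda>N. of_real (log_saddle_coeff r N * t ^ N)) sums eval_fps L (of_real t)"
    by (simp add: log_saddle_fps_complex_nth)
  then show s: "summable (\<lambda>N. log_saddle_coeff r N * t ^ N)"
    using summable_of_real_iff sums_summable by blast
  show "eval_fps L (of_real t) = of_real (log_saddle r t)"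
    using sums_unique2[OF ** sums_of_real[OF summable_sums[OF s]]] by (simp add: log_saddle_def)
qed

text \<open>The formal identity makes the Taylor series of \<open>Z\<close> vanish, and the identity
  theorem extends \<open>Z = 0\<close> from a neighbourhood of 0 to the disc of radius
  \<open>5/13\<close>.\<close>

lemma log_saddle_equation:
  assumes "\<bar>t\<bar> < 5/13"
  shows "(1 - exp (- real r * log_saddle r t)) * exp (- log_saddle r t) = t"
proof -
  define a where "a = inverse (of_nat r :: complex)"
  define Z where "Z = (\<lambda>z. (1 - exp (- of_nat r * eval_fps L z)) * exp ((-1) * eval_fps L z) - z)"
  have "Z has_fps_expansion ((1 - (fps_exp (- of_nat r) oo L)) * (fps_exp (-1) oo L) - fps_X)"
    unfolding Z_def
    by (intro has_fps_expansion_diff has_fps_expansion_mult has_fps_expansion_1 has_fps_expansion_fps_X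
         exp_oo_expansion eval_log_saddle_fps_expansion log_saddle_fps_0)
  also have "fps_exp (- of_nat r) oo L = 1 - saddle_inv_fps (inverse (of_nat r))"
    by (rule exp_r_oo_log_saddle_fps) (use r in auto)
  also have "(1 - (1 - saddle_inv_fps (inverse (of_nat r)))) * (fps_exp (-1) oo L) - fps_X = 0"
    by (simp add: saddle_inv_fps_mult_exp_log_saddle_fps)
  finally have "Z (of_real t) = 0"
  proof (rule has_fps_expansion_0_analytic_continuation)
    show "Z holomorphic_on ball 0 (5/13)"
      unfolding Z_def eball_ereal [symmetric] by (intro holomorphic_intros eval_log_saddle_fps_holomorphic)
  qed (use assms in auto)
  then have "complex_of_real ((1 - exp (- real r * log_saddle r t)) * exp (- log_saddle r t)) = of_real t"
    unfolding Z_def eval_log_saddle_fps_real(1)[OF assms] by (simp flip: exp_of_real)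
  then show ?thesis by (simp only: of_real_eq_iff)
qed

definition exponent_coeff :: "nat \<Rightarrow> real" where
  "exponent_coeff N = (if N = r then 0 else log_saddle_coeff r N / (1 - real N / real r))"

text \<open>Convergence comes from holomorphy: \<open>R\<close> is holomorphic on the disc, so its
  Taylor series, which is \<open>exponent_fps\<close> over the complex numbers, converges to it
  there.\<close>

lemma exponent_coeff_sums:
  assumes "\<bar>t\<bar> < 5/13"
  shows "(\<lambda>N. exponent_coeff N * t ^ N) sums
    ((\<Sum>j=1..r. 1 / real j * t ^ (r - j) * exp (- real j * log_saddle r t))
       - (real r + 1) * t ^ r * log_saddle r t + log_saddle r t - 1 / real r
       + 1 / real r * (\<Sum>j=2..r. 1 / real j) * t ^ r)" (is "_ sums ?R")
proof -
  define R where "R = (\<lambda>z. (\<Sum>j=1..r. (1 / of_nat j * z ^ (r - j)) * exp (- of_nat j * eval_fps L z))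
     - (of_nat r + 1) * z ^ r * eval_fps L z + eval_fps L z - inverse (of_nat r)
     + (inverse (of_nat r) * (\<Sum>j=2..r. 1 / of_nat j)) * z ^ r)"
  have "R has_fps_expansion exponent_fps r (inverse (of_nat r))"
    unfolding R_def exponent_fps_def[OF less_le_trans[OF zero_less_numeral r] refl]
    by (intro has_fps_expansion_add has_fps_expansion_diff has_fps_expansion_sum has_fps_expansion_mult
         has_fps_expansion_const has_fps_expansion_fps_X_power exp_oo_expansion eval_log_saddle_fps_expansion log_saddle_fps_0)
  then have "(\<lambda>n. fps_nth (exponent_fps r (inverse (of_nat r))) n * of_real t ^ n) sums R (of_real t)"
  proof (rule has_fps_expansion_imp_sums_complex)
    show "R holomorphic_on eball 0 (ereal (5/13))"
      unfolding R_def by (intro holomorphic_intros eval_log_saddle_fps_holomorphic)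
    show "ereal (cmod (of_real t)) < ereal (5/13)" using assms by simp
  qed
  also have "R (of_real t) = of_real ?R"
    unfolding R_def eval_log_saddle_fps_real(1)[OF assms] by (simp add: inverse_eq_divide flip: exp_of_real)
  also have "(\<lambda>n. fps_nth (exponent_fps r (inverse (of_nat r))) n * complex_of_real t ^ n) = (\<lambda>n. of_real (exponent_coeff n * t ^ n))"
    by (rule ext) (simp add: exponent_fps_nth[OF less_le_trans[OF zero_less_numeral r] refl] log_saddle_fps_complex_nth exponent_coeff_def)
  finally show ?thesis by (simp only: sums_of_real_iff)
qed

lemma log_saddle_nonneg: "0 \<le> t \<Longrightarrow> t < 5/13 \<Longrightarrow> 0 \<le> log_saddle r t"
  unfolding log_saddle_def by (intro suminf_nonneg eval_log_saddle_fps_real(2)) (auto intro!: mult_nonneg_nonneg log_saddle_coeff_nonneg)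

text \<open>Below the critical value the equation \<open>t = w * (1 - w) powr (1/r)\<close> has two
  solutions in the unit interval, and continuity from \<open>t = 0\<close> selects the smaller. To
  reach \<open>w = 2/3\<close> it would have to pass a scale \<open>s\<close> with
  \<open>s^2 >= 4/27\<close>, since \<open>exp (-2 * l) >= exp (- r * l)\<close>; this contradicts
  \<open>s <= 1/e\<close>.\<close>

lemma log_saddle_less:
  assumes t: "0 < t" "t \<le> exp (-1)"
  shows "exp (- real r * log_saddle r t) > 1/3"
proof (rule ccontr)
  assume "\<not> ?thesis"
  then have le: "exp (- real r * log_saddle r t) \<le> 1/3" by simp
  have t': "t < 5/13" using t exp_1_bounds by simp
  have eq: "log_saddle r s = Re (eval_fps L (of_real s))" if "s \<in> {0..t}" for s
    using eval_log_saddle_fps_real(1)[of s] that t' by simp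
  have "continuous_on {0..t} (\<lambda>s. Re (eval_fps L (of_real s)))"
  proof (rule continuous_on_Re, rule continuous_on_compose2[where g = "eval_fps L"])
    show "continuous_on (eball 0 (ereal (5/13))) (eval_fps L)"
      by (intro holomorphic_on_imp_continuous_on eval_log_saddle_fps_holomorphic)
  qed (use t' in \<open>auto intro!: continuous_intros\<close>)
  then have cont: "continuous_on {0..t} (log_saddle r)" by (subst continuous_on_cong[OF refl eq]) auto
  have "\<exists>s\<ge>0. s \<le> t \<and> exp (- real r * log_saddle r s) = 1/3"
  proof (rule IVT2')
    have "log_saddle r 0 = log_saddle_coeff r 0" using powser_zero[of "log_saddle_coeff r"] by (simp add: log_saddle_def)
    then show "1/3 \<le> exp (- real r * log_saddle r 0)" by simp
  qed (use t le cont in \<open>auto intro!: continuous_intros\<close>)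
  then obtain s where s: "0 \<le> s" "s \<le> t" "exp (- real r * log_saddle r s) = 1/3" by blast
  have "s = 2/3 * exp (- log_saddle r s)"
    using log_saddle_equation[of s] s(1,2) t' unfolding s(3) by simp
  then have "s\<^sup>2 = (2/3 * exp (- log_saddle r s))\<^sup>2"
    by (rule arg_cong)
  also have "\<dots> = 4/9 * (exp (- log_saddle r s))\<^sup>2"
    by (simp add: power2_eq_square)
  also have "(exp (- log_saddle r s))\<^sup>2 = exp (- 2 * log_saddle r s)"
    by (simp add: power2_eq_square flip: exp_add)
  finally have "s\<^sup>2 = 4/9 * exp (- 2 * log_saddle r s)" .
  moreover have "exp (- 2 * log_saddle r s) \<ge> exp (- real r * log_saddle r s)"
    using r log_saddle_nonneg[of s] s t' by (auto intro!: mult_right_mono)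
  ultimately have "s\<^sup>2 \<ge> 4/27" using s(3) by linarith
  moreover have "s\<^sup>2 \<le> (exp (-1))\<^sup>2" using s t by (intro power_mono) auto
  moreover have "(exp (-1::real))\<^sup>2 = exp (-2)" by (simp flip: exp_of_nat_mult)
  ultimately show False using exp_1_bounds by simp
qed

lemma log_saddle_saddle:
  assumes t: "0 < t" "t \<le> exp (-1)"
  defines "w \<equiv> t * exp (log_saddle r t)"
  shows "exp (- real r * log_saddle r t) = 1 - w" "0 < w" "w < 2/3" "t \<le> w" "w \<le> 2 * t"
    "0 \<le> log_saddle r t" "log_saddle r t \<le> 6 * t / r"
proof -
  have t': "t < 5/13" using t exp_1_bounds by simp
  show 1: "exp (- real r * log_saddle r t) = 1 - w"
    using log_saddle_equation[of t] t t' by (simp add: w_def exp_minus field_simps)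
  show 2: "0 < w" using t by (simp add: w_def)
  show 3: "w < 2/3" using log_saddle_less[OF t] 1 by simp
  show l: "0 \<le> log_saddle r t" by (rule log_saddle_nonneg) (use t t' in auto)
  then show "t \<le> w" using t by (simp add: w_def)
  have "exp (- 2 * log_saddle r t) \<ge> exp (- real r * log_saddle r t)"
    using l r by (auto intro!: mult_right_mono)
  then have "1/3 \<le> exp (- 2 * log_saddle r t)" using log_saddle_less[OF t] by linarith
  then have "inverse (exp (- 2 * log_saddle r t)) \<le> inverse (1/3)" by (rule le_imp_inverse_le) simp
  then have "exp (2 * log_saddle r t) \<le> 3" by (simp add: exp_minus)
  then have "(exp (log_saddle r t))\<^sup>2 \<le> 2\<^sup>2" by (simp flip: exp_of_nat_mult)
  then have "exp (log_saddle r t) \<le> 2" by (rule power2_le_imp_le) auto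
  then show w2: "w \<le> 2 * t" using t by (simp add: w_def)
  \<comment> \<open>The gain of \<open>1 / r\<close> in the last bound matters because
    \<open>log_saddle r t\<close> is later multiplied by \<open>r + 1\<close>.\<close>
  have "real r * log_saddle r t = - ln (1 - w)" using 1 3 by (metis ln_exp minus_mult_left minus_minus)
  also have "\<dots> = ln (1 + w / (1 - w))" using 3 by (simp add: field_simps ln_div)
  also have "\<dots> \<le> w / (1 - w)" using 2 3 by (intro ln_add_one_self_le_self) auto
  also have "\<dots> \<le> w / (1/3)" using 2 3 by (intro divide_left_mono) auto
  also have "\<dots> \<le> 6 * t" using w2 by simp
  finally show "log_saddle r t \<le> 6 * t / r" using r by (simp add: field_simps)
qed

text \<open>The coefficients at 0 and at \<open>r\<close> vanish, and those beyond \<open>r\<close>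
  have a geometric majorant. Factoring out \<open>t^r\<close> prepares the multiplication by
  \<open>n = t^(-r)\<close>.\<close>

lemma exponent_coeff_tail:
  assumes t: "0 < t" "t \<le> exp (-1)"
  shows "\<exists>E. \<bar>E\<bar> \<le> 200 * t \<and> (\<lambda>N. exponent_coeff N * t ^ N) sums ((\<Sum>N=1..<r. exponent_coeff N * t ^ N) + t ^ r * E)"
proof -
  have t': "t < 46/125" using t exp_1_bounds by simp
  define f where "f = (\<lambda>N. exponent_coeff N * t ^ N)"
  have sm: "summable f" unfolding f_def using exponent_coeff_sums[of t] t t' by (auto simp: sums_iff)
  have split: "suminf f = (\<Sum>N. f (N + Suc r)) + sum f {..<Suc r}"
    by (rule suminf_split_initial_segment[OF sm])
  have "sum f {..<Suc r} = sum f (insert 0 (insert r {1..<r}))"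
    using r by (intro arg_cong[of _ _ "sum f"]) auto
  also have "\<dots> = sum f {1..<r}" using r by (subst sum.insert) (auto simp: f_def exponent_coeff_def)
  finally have init: "sum f {..<Suc r} = sum f {1..<r}" .
  define q where "q = 13/5 * t"
  \<comment> \<open>\<open>q < 13/5 * 46/125 = 0.9568\<close>. Below,
    \<open>3 * 13/5 * 1000/43\<close> is about 181, whence the constant 200.\<close>
  have q: "0 < q" "q < 1" "1 - q > 43/1000" using t t' by (auto simp: q_def)
  have b: "\<bar>f (N + Suc r)\<bar> \<le> t ^ r * (3 * q * q ^ N)" for N
  proof -
    define m where "m = Suc N"
    have "exponent_coeff (r + m) = - (real r * log_saddle_coeff r (r + m)) / m"
      using r by (simp add: exponent_coeff_def field_simps m_def)
    then have "\<bar>exponent_coeff (r + m)\<bar> = real r * log_saddle_coeff r (r + m) / m"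
      using log_saddle_coeff_nonneg[of r "r + m"] by (simp add: abs_mult)
    also have "\<dots> \<le> real r * log_saddle_coeff r (r + m)"
      using mult_nonneg_nonneg[OF _ log_saddle_coeff_nonneg[of r "r + m"], of "real r"] by (simp add: m_def field_simps mult_nonneg_nonneg log_saddle_coeff_nonneg)
    also have "\<dots> \<le> 3 * (13/5) ^ m" by (rule log_saddle_coeff_bound) (use r in \<open>auto simp: m_def\<close>)
    finally have "\<bar>exponent_coeff (r + m)\<bar> * t ^ (r + m) \<le> 3 * (13/5) ^ m * t ^ (r + m)"
      using t by (intro mult_right_mono) auto
    also have "\<dots> = t ^ r * (3 * ((13/5) ^ m * t ^ m))" by (simp add: power_add)
    also have "(13/5) ^ m * t ^ m = q ^ m" unfolding q_def by (rule power_mult_distrib [symmetric])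
    finally show ?thesis using t by (simp add: f_def m_def abs_mult add.commute mult.assoc)
  qed
  have geo: "(\<lambda>N. t ^ r * (3 * q * q ^ N)) sums (t ^ r * (3 * q * (1 / (1 - q))))"
    using q by (intro sums_mult geometric_sums) auto
  have "\<bar>\<Sum>N. f (N + Suc r)\<bar> \<le> (\<Sum>N. t ^ r * (3 * q * q ^ N))"
    using norm_suminf_le[OF _ sums_summable[OF geo], of "\<lambda>N. f (N + Suc r)"] b by simp
  also have "\<dots> = t ^ r * (3 * q * (1 / (1 - q)))" using geo by (simp add: sums_iff)
  also have "\<dots> \<le> t ^ r * (200 * t)"
  proof (intro mult_left_mono)
    have "1 / (1 - q) \<le> 1000/43" using q by (simp add: field_simps)
    then have "3 * q * (1 / (1 - q)) \<le> 3 * q * (1000/43)" using q by (intro mult_left_mono) auto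
    then show "3 * q * (1 / (1 - q)) \<le> 200 * t" using t by (simp add: q_def)
  qed (use t in auto)
  finally have bd: "\<bar>\<Sum>N. f (N + Suc r)\<bar> \<le> t ^ r * (200 * t)" .
  show ?thesis
  proof (intro exI conjI)
    show "\<bar>(\<Sum>N. f (N + Suc r)) / t ^ r\<bar> \<le> 200 * t"
      using bd t by (simp add: abs_divide divide_le_eq mult.commute)
    show "(\<lambda>N. exponent_coeff N * t ^ N) sums ((\<Sum>N=1..<r. exponent_coeff N * t ^ N) + t ^ r * ((\<Sum>N. f (N + Suc r)) / t ^ r))"
      using summable_sums[OF sm] split init t by (simp add: f_def add.commute)
  qed
qed

end

lemma log_saddle_coeff_d:
  assumes "1 \<le> N" "N < r"
  shows "log_saddle_coeff r N / (1 - real N / real r) = d r N"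
proof -
  obtain M where M: "N = Suc M" using assms by (cases N) auto
  define z where "z = 1 + real N / real r"
  have z: "z > 0" using assms by (auto simp: z_def intro!: add_pos_nonneg)
  have 1: "pochhammer z M = Gamma (z + real M) / Gamma z"
    using z by (intro pochhammer_Gamma) (auto elim!: nonpos_Ints_cases)
  have 2: "z + real M = real N + real N / real r" by (simp add: z_def M)
  have 3: "fact N = Gamma (real N + 1)" by (simp add: Gamma_fact add.commute)
  have 4: "log_saddle_coeff r N = pochhammer z M / fact N / real r"
    unfolding log_saddle_coeff_def M log_saddle_fps_nth by (simp add: z_def M divide_inverse mult_ac)
  have 5: "1 - real N / real r = (real r - real N) / real r" using assms by (simp add: field_simps)
  have 6: "d r N = Gamma (real N + real N / real r) / ((real r - real N) * Gamma (real N + 1) * Gamma z)"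
    using assms by (simp add: d_def z_def)
  show ?thesis unfolding 4 1 2 3 5 6 using assms by simp
qed

subsection \<open>Counting permutations with bounded cycles\<close>

text \<open>The composition inserts \<open>x\<close> into the cycle of \<open>y\<close>, directly
  before \<open>y\<close>: the preimage of \<open>y\<close> is redirected to \<open>x\<close>, and
  \<open>x\<close> is sent to \<open>y\<close>.\<close>

lemma orbit_transpose_comp:
  assumes fin: "finite S" and p: "p permutes S" and x: "x \<notin> S" and y: "y \<in> S"
  shows "orbit (Transposition.transpose x y \<circ> p) x = insert x (orbit p y)"
    and "z \<in> S \<Longrightarrow> z \<notin> orbit p y \<Longrightarrow> orbit (Transposition.transpose x y \<circ> p) z = orbit p z"
proof -
  define q where "q = Transposition.transpose x y \<circ> p"
  have px: "p x = x" using p x by (simp add: permutes_not_in)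
  have qx: "q x = y" by (simp add: q_def px)
  have q: "q permutes insert x S"
    unfolding q_def using p y by (intro permutes_compose permutes_swap_id) (auto intro: permutes_subset)
  have permp: "permutation p" and permq: "permutation q"
    using p q fin by (auto simp: permutation_permutes)
  have sub: "orbit p u \<subseteq> S" if "u \<in> S" for u using permutes_orbit_subset[OF p that] .
  have q_eq: "q u = (if p u = y then x else p u)" if "u \<in> S" for u
    using p x that permutes_in_image[OF p, of u] by (auto simp: q_def Transposition.transpose_def)
  show "orbit (Transposition.transpose x y \<circ> p) x = insert x (orbit p y)" unfolding q_def [symmetric]
  proof (intro equalityI subsetI)
    fix u assume "u \<in> orbit q x"
    then show "u \<in> insert x (orbit p y)"
    proof induction
      case base
      then show ?case using qx permutation_self_in_orbit[OF permp, of y] by simp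
    next
      case (step v)
      from step.IH consider "v = x" | "v \<in> orbit p y" by auto
      then show ?case
      proof cases
        case 1
        then show ?thesis using qx permutation_self_in_orbit[OF permp, of y] by simp
      next
        case 2
        then have "v \<in> S" using sub[OF y] by auto
        then show ?thesis using q_eq[of v] orbit.step[OF 2] by simp
      qed
    qed
  next
    have xin: "x \<in> orbit q x" by (rule permutation_self_in_orbit[OF permq])
    have yin: "y \<in> orbit q x" using orbit.base[of q x] qx by simp
    fix u assume "u \<in> insert x (orbit p y)"
    then consider "u = x" | "u \<in> orbit p y" by auto
    then show "u \<in> orbit q x"
    proof cases
      case 2
      then show ?thesis
      proof induction
        case base
        then show ?case using q_eq[OF y] yin orbit.step[OF yin] by (auto split: if_splits)
      next
        case (step v)
        then have "v \<in> S" using sub[OF y] by auto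
        then show ?case using q_eq[of v] yin orbit.step[OF step.IH] by (auto split: if_splits)
      qed
    qed (use xin in simp)
  qed
  show "orbit (Transposition.transpose x y \<circ> p) z = orbit p z" if z: "z \<in> S" "z \<notin> orbit p y"
    unfolding q_def [symmetric]
  proof (rule sym, rule orbit_cong0)
    show "z \<in> orbit p z" by (rule permutation_self_in_orbit[OF permp])
    show "p \<in> orbit p z \<rightarrow> orbit p z" by (auto intro: orbit.step)
    fix u assume u: "u \<in> orbit p z"
    then have "p u \<in> orbit p z" by (rule orbit.step)
    moreover have "y \<notin> orbit p z" using z orbit_swap[OF permutation_self_in_orbit[OF permp]] by blast
    ultimately have "p u \<noteq> y" by auto
    then show "p u = q u" using q_eq[of u] u sub[OF z(1)] by auto
  qed
qed

definition bounded_perms :: "nat \<Rightarrow> 'a set \<Rightarrow> ('a \<Rightarrow> 'a) set" where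
  "bounded_perms r S = {p. p permutes S \<and> (\<forall>x\<in>S. card (orbit p x) \<le> r)}"

text \<open>The cycle through \<open>x\<close> is exempt from the bound \<open>r\<close> and has a
  prescribed length instead, so that it can be shortened point by point without reference to
  \<open>r\<close>.\<close>

definition pointed_perms :: "nat \<Rightarrow> 'a set \<Rightarrow> 'a \<Rightarrow> nat \<Rightarrow> ('a \<Rightarrow> 'a) set" where
  "pointed_perms r S x l = {p. p permutes S \<and> card (orbit p x) = l \<and> (\<forall>z\<in>S - orbit p x. card (orbit p z) \<le> r)}"

lemma finite_pointed_perms: "finite S \<Longrightarrow> finite (pointed_perms r S x l)"
  by (rule finite_subset[OF _ finite_permutations[of S]]) (auto simp: pointed_perms_def)

lemma pointed_perms_1:
  assumes "finite S" "x \<in> S"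
  shows "pointed_perms r S x 1 = bounded_perms r (S - {x})"
proof (intro equalityI subsetI)
  fix p assume p: "p \<in> pointed_perms r S x 1"
  then have pS: "p permutes S" and c: "card (orbit p x) = 1" by (auto simp: pointed_perms_def)
  have "permutation p" using pS assms(1) by (auto simp: permutation_permutes)
  then have "x \<in> orbit p x" by (rule permutation_self_in_orbit)
  moreover obtain u where "orbit p x = {u}" using c by (rule card_1_singletonE)
  ultimately have o: "orbit p x = {x}" by simp
  then have "p x = x" by (simp add: orbit_eq_singleton_iff)
  then have "p permutes (S - {x})" by (intro permutes_superset[OF pS]) auto
  then show "p \<in> bounded_perms r (S - {x})" using p o by (auto simp: bounded_perms_def pointed_perms_def)
next
  fix p assume p: "p \<in> bounded_perms r (S - {x})"
  then have pS: "p permutes (S - {x})" by (auto simp: bounded_perms_def)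
  then have "p x = x" by (auto simp: permutes_not_in)
  then have "orbit p x = {x}" by (simp add: orbit_eq_singleton_iff)
  then show "p \<in> pointed_perms r S x 1"
    using p permutes_subset[OF pS] by (auto simp: bounded_perms_def pointed_perms_def)
qed

text \<open>The permutation \<open>transpose x (p x) \<circ> p\<close> is \<open>p\<close> with \<open>x\<close> removed from its cycle.\<close>
lemma pointed_perms_Suc:
  assumes fin: "finite S" and x: "x \<notin> S" and l: "l \<ge> 1"
  shows "pointed_perms r (insert x S) x (Suc l) = (\<Union>y\<in>S. (\<lambda>p. Transposition.transpose x y \<circ> p) ` pointed_perms r S y l)"
proof (intro equalityI subsetI)
  fix p assume p: "p \<in> pointed_perms r (insert x S) x (Suc l)"
  then have pS: "p permutes insert x S" and c: "card (orbit p x) = Suc l"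
    and b: "\<And>z. z \<in> S \<Longrightarrow> z \<notin> orbit p x \<Longrightarrow> card (orbit p z) \<le> r" by (auto simp: pointed_perms_def)
  define y where "y = p x"
  define q where "q = Transposition.transpose x y \<circ> p"
  have "y \<noteq> x"
  proof
    assume "y = x"
    then have "orbit p x = {x}" by (simp add: orbit_eq_singleton_iff y_def)
    then show False using c l by simp
  qed
  then have y: "y \<in> S" using permutes_in_image[OF pS, of x] by (auto simp: y_def)
  have qS: "q permutes S" unfolding q_def y_def by (rule permutes_insert_lemma[OF pS])
  have pq: "p = Transposition.transpose x y \<circ> q" by (simp add: q_def fun_eq_iff)
  note o = orbit_transpose_comp[OF fin qS x y, folded pq]
  have sub: "orbit q y \<subseteq> S" by (rule permutes_orbit_subset[OF qS y])
  then have xn: "x \<notin> orbit q y" using x by auto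
  have "q \<in> pointed_perms r S y l"
    unfolding pointed_perms_def using qS c o b sub x xn finite_subset[OF sub fin] by (auto simp: card_insert_if)
  then show "p \<in> (\<Union>y\<in>S. (\<lambda>p. Transposition.transpose x y \<circ> p) ` pointed_perms r S y l)"
    using y pq by blast
next
  fix p assume "p \<in> (\<Union>y\<in>S. (\<lambda>p. Transposition.transpose x y \<circ> p) ` pointed_perms r S y l)"
  then obtain y q where y: "y \<in> S" and q: "q \<in> pointed_perms r S y l" and pq: "p = Transposition.transpose x y \<circ> q" by auto
  then have qS: "q permutes S" by (auto simp: pointed_perms_def)
  note o = orbit_transpose_comp[OF fin qS x y, folded pq]
  have sub: "orbit q y \<subseteq> S" by (rule permutes_orbit_subset[OF qS y])
  then have xn: "x \<notin> orbit q y" using x by auto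
  have "p permutes insert x S"
    unfolding pq using qS y by (intro permutes_compose permutes_swap_id) (auto intro: permutes_subset)
  then show "p \<in> pointed_perms r (insert x S) x (Suc l)"
    unfolding pointed_perms_def using q o sub x xn finite_subset[OF sub fin] by (auto simp: card_insert_if pointed_perms_def)
qed

lemma card_pointed_perms_Suc:
  fixes S :: "'a set"
  assumes fin: "finite S" and x: "x \<notin> S" and l: "l \<ge> 1"
  shows "card (pointed_perms r (insert x S) x (Suc l)) = (\<Sum>y\<in>S. card (pointed_perms r S y l))"
proof -
  \<comment> \<open>The value at \<open>x\<close> recovers \<open>y\<close>, which makes the union
    over \<open>y\<close> disjoint.\<close>
  have at_x: "(Transposition.transpose x y \<circ> p) x = y" if "p \<in> pointed_perms r S y l" for p y
    using that x by (auto simp: pointed_perms_def permutes_not_in)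
  have "card (pointed_perms r (insert x S) x (Suc l)) =
    (\<Sum>y\<in>S. card ((\<lambda>p. Transposition.transpose x y \<circ> p) ` pointed_perms r S y l))"
    unfolding pointed_perms_Suc[OF assms]
  proof (rule card_UN_disjoint)
    show "\<forall>y\<in>S. \<forall>y'\<in>S. y \<noteq> y' \<longrightarrow> (\<lambda>p. Transposition.transpose x y \<circ> p) ` pointed_perms r S y l \<inter>
       (\<lambda>p. Transposition.transpose x y' \<circ> p) ` pointed_perms r S y' l = {}"
    proof (intro ballI impI equals0I)
      fix y y' f
      assume "y \<noteq> y'" and f: "f \<in> (\<lambda>p. Transposition.transpose x y \<circ> p) ` pointed_perms r S y l \<inter>
        (\<lambda>p. Transposition.transpose x y' \<circ> p) ` pointed_perms r S y' l"
      from f have "f x = y" using at_x by (elim IntE imageE) (simp only:)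
      moreover from f have "f x = y'" using at_x by (elim IntE imageE) (simp only:)
      ultimately show False using \<open>y \<noteq> y'\<close> by simp
    qed
  qed (use fin in \<open>auto simp: finite_pointed_perms\<close>)
  also have "\<dots> = (\<Sum>y\<in>S. card (pointed_perms r S y l))"
  proof (intro sum.cong refl card_image inj_onI)
    fix y and p q :: "'a \<Rightarrow> 'a" assume "Transposition.transpose x y \<circ> p = Transposition.transpose x y \<circ> q"
    then have "Transposition.transpose x y \<circ> (Transposition.transpose x y \<circ> p) = Transposition.transpose x y \<circ> (Transposition.transpose x y \<circ> q)" by simp
    then show "p = q" by (simp add: o_assoc)
  qed
  finally show ?thesis .
qed

lemma card_bounded_perms_split:
  assumes fin: "finite S" and x: "x \<in> S"
  shows "card (bounded_perms r S) = (\<Sum>l=1..min r (card S). card (pointed_perms r S x l))"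
proof -
  have "bounded_perms r S = (\<Union>l\<in>{1..min r (card S)}. pointed_perms r S x l)"
  proof (intro equalityI subsetI)
    fix p assume p: "p \<in> bounded_perms r S"
    then have pS: "p permutes S" by (auto simp: bounded_perms_def)
    have sub: "orbit p x \<subseteq> S" by (rule permutes_orbit_subset[OF pS x])
    then have "card (orbit p x) \<le> card S" "finite (orbit p x)" using fin by (auto intro: card_mono finite_subset)
    moreover have "x \<in> orbit p x" using pS fin by (intro permutation_self_in_orbit) (auto simp: permutation_permutes)
    ultimately have "card (orbit p x) \<in> {1..min r (card S)}" "p \<in> pointed_perms r S x (card (orbit p x))"
      using p x by (auto simp: bounded_perms_def pointed_perms_def card_gt_0_iff Suc_le_eq)
    then show "p \<in> (\<Union>l\<in>{1..min r (card S)}. pointed_perms r S x l)" by blast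
  next
    fix p assume "p \<in> (\<Union>l\<in>{1..min r (card S)}. pointed_perms r S x l)"
    then have p: "p permutes S" "card (orbit p x) \<le> r" "\<And>z. z \<in> S \<Longrightarrow> z \<notin> orbit p x \<Longrightarrow> card (orbit p z) \<le> r"
      by (auto simp: pointed_perms_def)
      have "card (orbit p z) \<le> r" if "z \<in> S" for z
    proof (cases "z \<in> orbit p x")
      case True
      then have "orbit p z = orbit p x"
        using orbit_cyclic_eq3[OF cyclic_on_orbit[OF p(1) fin]] by blast
      then show ?thesis using p by simp
    qed (use p that in auto)
    then show "p \<in> bounded_perms r S" using p by (auto simp: bounded_perms_def)
  qed
  also have "card \<dots> = (\<Sum>l\<in>{1..min r (card S)}. card (pointed_perms r S x l))"
    by (rule card_UN_disjoint) (auto simp: finite_pointed_perms fin, auto simp: pointed_perms_def)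
  finally show ?thesis .
qed

text \<open>The two counts feed each other. Removing points shortens the pointed cycle until
  \<open>l = 1\<close>, where a bounded count on the remaining letters is left; summing pointed
  counts over \<open>l\<close> gives the next bounded count through the recurrence for
  \<open>h\<close>. Directly: \<open>(n-1) * ... * (n-l+1)\<close> cycles through \<open>x\<close>,
  times \<open>fact (n-l) * h (n-l)\<close>.\<close>

lemma card_pointed_bounded_perms:
  fixes h :: "nat \<Rightarrow> real" and S :: "'a set"
  assumes h0: "h 0 = 1" and h: "\<And>n. n > 0 \<Longrightarrow> real n * h n = (\<Sum>l=1..min r n. h (n - l))"
  assumes "finite S" "card S = n"
  shows "card (bounded_perms r S) = fact n * h n"
    and "x \<in> S \<Longrightarrow> 1 \<le> l \<Longrightarrow> l \<le> n \<Longrightarrow> card (pointed_perms r S x l) = fact (n - 1) * h (n - l)"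
  using assms(3,4)
proof (induction n arbitrary: S x l)
  case 0
  {
    case 1
    then have "bounded_perms r S = {id}" by (auto simp: bounded_perms_def)
    then show ?case by (simp add: h0)
  next
    case 2
    then show ?case by simp
  }
next
  case (Suc n)
  have pointed: "card (pointed_perms r S x l) = fact n * h (Suc n - l)"
    if S: "finite S" "card S = Suc n" and x: "x \<in> S" and l: "1 \<le> l" "l \<le> Suc n" for S :: "'a set" and x l
  proof (cases "l = 1")
    case True
    then show ?thesis using Suc(1)[of "S - {x}"] S x by (simp add: pointed_perms_1 [simplified])
  next
    case False
    then obtain m where m: "l = Suc m" "m \<ge> 1" using l by (cases l) auto
    define T where "T = S - {x}"
    have T: "finite T" "x \<notin> T" "S = insert x T" "card T = n" using S x by (auto simp: T_def)
    have "real (card (pointed_perms r S x l)) = (\<Sum>y\<in>T. card (pointed_perms r T y m))"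
      using card_pointed_perms_Suc[OF T(1,2) m(2)] by (simp add: T(3) m(1))
    also have "\<dots> = (\<Sum>y\<in>T. fact (n - 1) * h (n - m))"
      using Suc(2)[OF _ m(2) _ T(1,4)] l m by simp
    also have "\<dots> = real n * fact (n - 1) * h (n - m)" by (simp add: T(4))
    also have "real n * fact (n - 1) = fact n" using l m by (cases n) auto
    finally show ?thesis by (simp add: m)
  qed
  {
    case 1
    then obtain x where x: "x \<in> S" by fastforce
    have "card (bounded_perms r S) = (\<Sum>l=1..min r (Suc n). real (card (pointed_perms r S x l)))"
      using card_bounded_perms_split[OF 1(1) x, of r] 1 by simp
    also have "\<dots> = (\<Sum>l=1..min r (Suc n). fact n * h (Suc n - l))"
      by (intro sum.cong refl pointed) (use 1 x in auto)
    also have "\<dots> = fact n * (real (Suc n) * h (Suc n))"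
      using h[of "Suc n"] by (simp add: sum_distrib_left)
    finally show ?case by simp
  next
    case 2
    then show ?case using pointed by simp
  }
qed

text \<open>The recurrence and \<open>h 0 = 1\<close> determine \<open>h\<close>, so any solution
  can be identified with \<open>nu\<close>: the Taylor coefficients of the generating function, and
  \<open>1 / fact n\<close> for \<open>r = 1\<close>.\<close>

lemma nu_eq:
  assumes h0: "h 0 = 1" and h: "\<And>n. n > 0 \<Longrightarrow> real n * h n = (\<Sum>l=1..min r n. h (n - l))"
  shows "nu n r = h n"
proof -
  have fin: "finite {p. p permutes {1..n}}" by (rule finite_permutations) simp
  have "nu n r = card ({p. p permutes {1..n}} \<inter> {p. \<forall>x\<in>{1..n}. card (orbit p x) \<le> r}) / card {p. p permutes {1..n}}"
    unfolding nu_def using fin permutes_id[of "{1..n}"] by (subst measure_pmf_of_set) (auto simp del: permutes_id)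
  also have "{p. p permutes {1..n}} \<inter> {p. \<forall>x\<in>{1..n}. card (orbit p x) \<le> r} = bounded_perms r {1..n}"
    by (auto simp: bounded_perms_def)
  also have "real (card (bounded_perms r {1..n})) = fact n * h n"
    by (rule card_pointed_bounded_perms[OF h0 h]) auto
  also have "real (card {p. p permutes {1..n}}) = fact n" by (simp add: card_permutations)
  finally show ?thesis by simp
qed

subsection \<open>Cauchy's formula and the Gaussian approximation\<close>

definition cpoly :: "nat \<Rightarrow> complex \<Rightarrow> complex" where
  "cpoly r z = (\<Sum>j=1..r. z ^ j / of_nat j)"

text \<open>The argument is negated because the contour integral runs over \<open>{0..2 * pi}\<close>: translating it to
  \<open>{-pi..pi}\<close> changes the sign of \<open>cis t\<close>.\<close>
lemma nu_expansion:
  obtains G :: "complex fps" where "(\<lambda>z. exp (cpoly r (- z))) has_fps_expansion G"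
    "\<And>n. nu n r = Re ((-1) ^ n * fps_nth G n)"
proof
  define p where "p = (\<Sum>j=1..r. fps_const ((-1) ^ j / of_nat j) * fps_X ^ j :: complex fps)"
  define G where "G = fps_exp 1 oo p"
  have p0: "fps_nth p 0 = 0" by (simp add: p_def fps_sum_nth)
  have "(\<lambda>z. \<Sum>j=1..r. (-1) ^ j / of_nat j * z ^ j) has_fps_expansion p"
    unfolding p_def by (intro has_fps_expansion_sum has_fps_expansion_mult has_fps_expansion_const has_fps_expansion_fps_X_power)
  also have "(\<lambda>z. \<Sum>j=1..r. (-1) ^ j / of_nat j * z ^ j) = (\<lambda>z. cpoly r (- z))"
  proof (intro ext)
    fix z :: complex
    have "(- z) ^ j = (-1) ^ j * z ^ j" for j by (rule power_minus)
    then show "(\<Sum>j=1..r. (-1) ^ j / of_nat j * z ^ j) = cpoly r (- z)"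
      unfolding cpoly_def by (intro sum.cong refl) simp
  qed
  finally have "(exp \<circ> (\<lambda>z. cpoly r (- z))) has_fps_expansion G"
    unfolding G_def by (intro has_fps_expansion_compose has_fps_expansion_exp1 p0)
  then show "(\<lambda>z. exp (cpoly r (- z))) has_fps_expansion G" by (simp add: o_def)
  \<comment> \<open>\<open>fps_deriv p\<close> is a truncated geometric series, so comparing
    coefficients gives the cycle recurrence, up to the signs of the negated argument.\<close>
  have G': "fps_deriv G = G * fps_deriv p"
    unfolding G_def by (simp add: fps_compose_deriv p0)
  have rec: "of_nat n * fps_nth G n = (\<Sum>l=1..min r n. (-1) ^ l * fps_nth G (n - l))" if n: "n > 0" for n
  proof -
    obtain m where m: "n = Suc m" using n by (cases n) auto
    have "of_nat n * fps_nth G n = fps_nth (fps_deriv G) m" by (simp add: m)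
    also have "\<dots> = fps_nth (\<Sum>j=1..r. fps_const ((-1) ^ j) * (fps_X ^ (j - 1) * G)) m"
    proof -
      have "fps_deriv p = (\<Sum>j=1..r. fps_const ((-1) ^ j) * fps_X ^ (j - 1))"
        unfolding p_def fps_deriv_sum
      proof (intro sum.cong refl)
        fix j assume j: "j \<in> {1..r}"
        have "fps_deriv (fps_const ((-1) ^ j / of_nat j) * fps_X ^ j :: complex fps) =
           fps_const ((-1) ^ j / of_nat j) * fps_const (of_nat j) * fps_X ^ (j - 1)"
          by (simp add: fps_deriv_power fps_of_nat mult.assoc)
        also have "fps_const ((-1) ^ j / of_nat j) * fps_const (of_nat j) = fps_const ((-1) ^ j :: complex)"
          using j by simp
        finally show "fps_deriv (fps_const ((-1) ^ j / of_nat j) * fps_X ^ j :: complex fps) =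
           fps_const ((-1) ^ j) * fps_X ^ (j - 1)" .
      qed
      then show ?thesis unfolding G' by (simp add: sum_distrib_left mult_ac)
    qed
    also have "\<dots> = (\<Sum>j=1..r. if j \<le> n then (-1) ^ j * fps_nth G (n - j) else 0)"
      unfolding fps_sum_nth by (intro sum.cong refl) (auto simp: fps_X_power_mult_nth m Suc_diff_le)
    also have "\<dots> = (\<Sum>j=1..min r n. (-1) ^ j * fps_nth G (n - j))"
      by (intro sum.mono_neutral_cong_right) auto
    finally show ?thesis .
  qed
  show "nu n r = Re ((-1) ^ n * fps_nth G n)" for n
  proof (rule nu_eq)
    show "Re ((- 1) ^ 0 * fps_nth G 0) = 1" by (simp add: G_def fps_compose_nth)
    fix n :: nat assume n: "n > 0"
    have "of_nat n * ((-1) ^ n * fps_nth G n) = (-1) ^ n * (of_nat n * fps_nth G n)" by simp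
    also have "\<dots> = (\<Sum>l=1..min r n. (-1) ^ n * ((-1) ^ l * fps_nth G (n - l)))"
      unfolding rec[OF n] by (rule sum_distrib_left)
    also have "\<dots> = (\<Sum>l=1..min r n. (-1) ^ (n - l) * fps_nth G (n - l))"
    proof (intro sum.cong refl)
      fix l assume l: "l \<in> {1..min r n}"
      have "(-1) ^ n * (-1) ^ l = ((-1) ^ (n - l) :: complex)"
        using l by (simp add: minus_one_power_iff)
      then show "(-1) ^ n * ((-1) ^ l * fps_nth G (n - l)) = (-1) ^ (n - l) * fps_nth G (n - l)"
        by (simp flip: mult.assoc)
    qed
    finally have "Re (of_nat n * ((-1) ^ n * fps_nth G n)) = Re (\<Sum>l=1..min r n. (-1) ^ (n - l) * fps_nth G (n - l))"
      by (rule arg_cong)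
    then show "real n * Re ((- 1) ^ n * fps_nth G n) = (\<Sum>l=1..min r n. Re ((- 1) ^ (n - l) * fps_nth G (n - l)))"
      by simp
  qed
qed

text \<open>Naming the complex coefficient \<open>c\<close> and taking its real part spares a proof
  that the coefficient is real.\<close>

lemma nu_integral:
  assumes x: "x > 0"
  obtains c where "((\<lambda>t. exp (cpoly r (of_real x * cis t)) * cis (- real n * t)) has_integral (complex_of_real (2 * pi * x ^ n) * c)) {-pi..pi}"
    "nu n r = Re c"
proof -
  obtain G :: "complex fps" where G: "(\<lambda>z. exp (cpoly r (- z))) has_fps_expansion G"
    "\<And>n. nu n r = Re ((-1) ^ n * fps_nth G n)" by (rule nu_expansion) blast
  define f where "f = (\<lambda>z. exp (cpoly r (- z)))"
  have hol: "f holomorphic_on A" for A unfolding f_def cpoly_def by (intro holomorphic_intros) auto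
  have nth: "fps_nth G n = (deriv ^^ n) f 0 / fact n"
    unfolding f_def by (rule fps_nth_fps_expansion[OF G(1)])
  define s :: complex where "s = (-1) ^ n"
  have s: "s \<noteq> 0" "s * s = 1" "1 / s = s" by (auto simp: s_def minus_one_power_iff)
  define I where "I = 2 * pi * \<i> * fps_nth G n"
  have "((\<lambda>u. f u / (u - 0) ^ Suc n) has_contour_integral ((2 * pi * \<i>) / (fact n) * (deriv ^^ n) f 0)) (circlepath 0 x)"
    by (rule Cauchy_has_contour_integral_higher_derivative_circlepath)
       (use x hol in \<open>auto intro: holomorphic_on_imp_continuous_on\<close>)
  then have "((\<lambda>u. f u / u ^ Suc n) has_contour_integral I) (part_circlepath 0 x 0 (2 * pi))"
    by (simp add: I_def nth circlepath_def)
  then have "((\<lambda>t. f (0 + x * cis t) / (0 + x * cis t) ^ Suc n * x * \<i> * cis t) has_integral I) {0..2 * pi}"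
    by (subst (asm) has_contour_integral_part_circlepath_iff) auto
  then have "((\<lambda>t. f (x * cis t) / (x * cis t) ^ Suc n * x * \<i> * cis t) has_integral I) (cbox 0 (2 * pi))"
    by simp
  \<comment> \<open>The translation puts \<open>t = 0\<close>, where the integrand is largest, in
    the middle of the interval.\<close>
  from has_integral_affinity'[OF this, of 1 pi]
  have "((\<lambda>t. f (x * cis (t + pi)) / (x * cis (t + pi)) ^ Suc n * x * \<i> * cis (t + pi)) has_integral I) {-pi..pi}"
    by (simp add: algebra_simps)
  also have "(\<lambda>t. f (x * cis (t + pi)) / (x * cis (t + pi)) ^ Suc n * x * \<i> * cis (t + pi)) =
    (\<lambda>t. \<i> * s / x ^ n * (exp (cpoly r (of_real x * cis t)) * cis (- real n * t)))"
  proof (rule ext)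
    fix t
    define C E where "C = cis t ^ n" and "E = exp (cpoly r (of_real x * cis t))"
    have 1: "cis (t + pi) = - cis t" by (simp add: cis_mult [symmetric])
    have nz: "C \<noteq> 0" "cis t \<noteq> 0" by (auto simp: C_def)
    have "cis (- real n * t) * C = 1" by (simp add: C_def Complex.DeMoivre cis_mult)
    then have 2: "cis (- real n * t) = 1 / C" using nz by (simp add: field_simps)
    have 3: "(x * - cis t) ^ Suc n = x * - cis t * (s * (x ^ n * C))"
    proof -
      have "x * - cis t = (-1) * (x * cis t)" by simp
      then have "(x * - cis t) ^ n = s * (x ^ n * C)"
        by (simp only: power_mult_distrib s_def C_def of_real_power)
      then show ?thesis by (simp only: power_Suc)
    qed
    have 4: "f (x * - cis t) = E" by (simp add: f_def E_def)
    have "f (x * cis (t + pi)) / (x * cis (t + pi)) ^ Suc n * x * \<i> * cis (t + pi) = \<i> * (1 / s) / x ^ n * (E * (1 / C))"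
      unfolding 1 3 4 using x nz s by (simp add: field_simps)
    then show "f (x * cis (t + pi)) / (x * cis (t + pi)) ^ Suc n * x * \<i> * cis (t + pi) =
      \<i> * s / x ^ n * (exp (cpoly r (of_real x * cis t)) * cis (- real n * t))"
      unfolding 2 E_def s(3) .
  qed
  finally have "((\<lambda>t. (- \<i> * s * x ^ n) * (\<i> * s / x ^ n * (exp (cpoly r (of_real x * cis t)) * cis (- real n * t))))
      has_integral ((- \<i> * s * x ^ n) * I)) {-pi..pi}"
    by (rule has_integral_mult_right)
  also have "(\<lambda>t. (- \<i> * s * x ^ n) * (\<i> * s / x ^ n * (exp (cpoly r (of_real x * cis t)) * cis (- real n * t))))
     = (\<lambda>t. exp (cpoly r (of_real x * cis t)) * cis (- real n * t))"
  proof (rule ext)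
    fix t
    define Y where "Y = exp (cpoly r (of_real x * cis t)) * cis (- real n * t)"
    have "(- \<i> * s * x ^ n) * (\<i> * s / x ^ n * Y) = (s * s) * Y" using x by (simp add: field_simps)
    then show "(- \<i> * s * x ^ n) * (\<i> * s / x ^ n * (exp (cpoly r (of_real x * cis t)) * cis (- real n * t)))
       = exp (cpoly r (of_real x * cis t)) * cis (- real n * t)" unfolding s(2) Y_def by simp
  qed
  also have "(- \<i> * s * x ^ n) * I = complex_of_real (2 * pi * x ^ n) * ((-1) ^ n * fps_nth G n)"
    by (simp add: I_def s_def mult_ac)
  finally show ?thesis by (rule that) (rule G(2))
qed

text \<open>Mean value inequality on a half-plane, where the derivative has norm at most
  \<open>exp M\<close>. Controlling only real parts preserves Gaussian decay when two exponents are
  compared.\<close>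

lemma norm_exp_diff_le:
  fixes a b :: complex
  assumes "Re a \<le> M" "Re b \<le> M"
  shows "norm (exp a - exp b) \<le> exp M * norm (a - b)"
proof (rule field_differentiable_bound[of "{z. Re z \<le> M}" exp exp])
  show "convex {z. Re z \<le> M}" by (rule convex_halfspace_Re_le)
  show "(exp has_field_derivative exp z) (at z within {z. Re z \<le> M})" for z :: complex
    by (rule DERIV_subset[OF DERIV_exp]) auto
qed (use assms in auto)

section \<open>Gaussian integrals and local comparison on the circle\<close>

lemma has_bochner_integral_gauss:
  assumes a: "a > 0"
  shows "has_bochner_integral lborel (\<lambda>x. exp (- a * x\<^sup>2)) (sqrt (pi / a))"
    and "has_bochner_integral lborel (\<lambda>x. exp (- a * x\<^sup>2) * \<bar>x\<bar> ^ (2 * k + 1)) (fact k / a ^ Suc k)"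
proof -
  define \<sigma> where "\<sigma> = 1 / sqrt (2 * a)"
  have \<sigma>: "\<sigma> > 0" "\<sigma>\<^sup>2 = 1 / (2 * a)" using a by (auto simp: \<sigma>_def power_divide)
  have nd: "normal_density 0 \<sigma> x = exp (- a * x\<^sup>2) / sqrt (pi / a)" for x
    using a by (simp add: normal_density_def \<sigma>)
  have s: "sqrt (pi / a) > 0" using a by simp
  have "has_bochner_integral lborel (normal_density 0 \<sigma>) 1"
    using integrable_normal_moment[OF \<sigma>(1), of 0 0] integral_normal_density[OF \<sigma>(1), of 0]
    by (simp add: has_bochner_integral_iff)
  then have "has_bochner_integral lborel (\<lambda>x. normal_density 0 \<sigma> x * sqrt (pi / a)) (1 * sqrt (pi / a))"
    by (intro has_bochner_integral_mult_left)
  then show "has_bochner_integral lborel (\<lambda>x. exp (- a * x\<^sup>2)) (sqrt (pi / a))"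
    unfolding nd using s a by simp
  have "has_bochner_integral lborel (\<lambda>x. normal_density 0 \<sigma> x * \<bar>x - 0\<bar> ^ (2 * k + 1)) (2^k * \<sigma>^(2 * k + 1) * fact k * sqrt (2 / pi))"
    by (rule normal_moment_abs_odd[OF \<sigma>(1)])
  then have "has_bochner_integral lborel (\<lambda>x. normal_density 0 \<sigma> x * \<bar>x - 0\<bar> ^ (2 * k + 1) * sqrt (pi / a))
     (2^k * \<sigma>^(2 * k + 1) * fact k * sqrt (2 / pi) * sqrt (pi / a))"
    by (intro has_bochner_integral_mult_left)
  also have "(\<lambda>x. normal_density 0 \<sigma> x * \<bar>x - 0\<bar> ^ (2 * k + 1) * sqrt (pi / a)) = (\<lambda>x. exp (- a * x\<^sup>2) * \<bar>x\<bar> ^ (2 * k + 1))"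
    unfolding nd using s a by (simp add: field_simps)
  also have "2^k * \<sigma>^(2 * k + 1) * fact k * sqrt (2 / pi) * sqrt (pi / a) = fact k / a ^ Suc k"
  proof -
    have "sqrt (2 / pi) * sqrt (pi / a) = sqrt (4 / (2 * a))" by (simp flip: real_sqrt_mult)
    also have "\<dots> = 2 * \<sigma>" by (simp only: real_sqrt_divide \<sigma>_def) simp
    finally have 1: "sqrt (2 / pi) * sqrt (pi / a) = 2 * \<sigma>" .
    have "2^k * \<sigma>^(2 * k + 1) * fact k * sqrt (2 / pi) * sqrt (pi / a) = 2^k * \<sigma>^(2 * k + 1) * fact k * (2 * \<sigma>)"
      unfolding 1 [symmetric] by simp
    also have "\<dots> = fact k * (2 * \<sigma>\<^sup>2) ^ Suc k"
    proof -
      have "(\<sigma>\<^sup>2) ^ Suc k = \<sigma> ^ (2 * Suc k)" by (rule power_mult [symmetric])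
      also have "\<dots> = \<sigma> ^ (2 * k + 1) * \<sigma>" by simp
      finally have "(\<sigma>\<^sup>2) ^ Suc k = \<sigma> ^ (2 * k + 1) * \<sigma>" .
      moreover have "(2 * \<sigma>\<^sup>2) ^ Suc k = 2 ^ Suc k * (\<sigma>\<^sup>2) ^ Suc k" by (rule power_mult_distrib)
      ultimately show ?thesis by simp
    qed
    also have "\<dots> = fact k / a ^ Suc k" using a by (simp add: \<sigma>(2) power_divide)
    finally show ?thesis .
  qed
  finally show "has_bochner_integral lborel (\<lambda>x. exp (- a * x\<^sup>2) * \<bar>x\<bar> ^ (2 * k + 1)) (fact k / a ^ Suc k)" .
qed

text \<open>The Taylor remainder leaves the factor \<open>1/2 - 1/24\<close>. The weaker
  \<open>1/3\<close> is the rate of the common majorant \<open>exp (- v / 3 * t^2)\<close> used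
  below.\<close>

lemma cos_le: "\<bar>u\<bar> \<le> 1 \<Longrightarrow> u\<^sup>2 / 3 \<le> 1 - cos (u::real)"
proof -
  assume u: "\<bar>u\<bar> \<le> 1"
  have "\<bar>Re (iexp u - (\<Sum>k\<le>3. (\<i> * u) ^ k / fact k))\<bar> \<le> \<bar>u\<bar> ^ 4 / 24"
    by (rule order_trans[OF abs_Re_le_cmod]) (use iexp_approx1[of u 3] in \<open>simp add: fact_numeral\<close>)
  moreover have "Re (iexp u - (\<Sum>k\<le>3. (\<i> * u) ^ k / fact k)) = cos u - 1 + u\<^sup>2 / 2"
    by (simp add: numeral_3_eq_3 fact_numeral power2_eq_square Re_exp)
  moreover have "\<bar>u\<bar> ^ 4 \<le> u\<^sup>2"
    using u power_decreasing[of 2 4 "\<bar>u\<bar>"] by simp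
  ultimately have "cos u - 1 + u\<^sup>2 / 2 \<le> u\<^sup>2 / 24" by linarith
  then show ?thesis using zero_le_power2[of u] by linarith
qed

lemma iexp_cubic: "norm (iexp u - (1 + \<i> * of_real u - (of_real u)\<^sup>2 / 2)) \<le> \<bar>u\<bar> ^ 3 / 6"
proof -
  have "(\<Sum>k\<le>2. (\<i> * complex_of_real u) ^ k / fact k) = 1 + \<i> * of_real u - (of_real u)\<^sup>2 / 2"
    by (simp add: numeral_2_eq_2 complex_eq_iff)
  then show ?thesis using iexp_approx1[of u 2] by (simp add: fact_numeral)
qed

text \<open>An explicit integrable \<open>b\<close> dominates the difference between the truncated
  \<open>g\<close> and the full Gaussian. Beyond \<open>\<rho>\<close> the Gaussian is at most
  \<open>(|t| / \<rho>)^3 * exp (- v / 3 * t^2)\<close>, so its tail is absorbed in the cubic moment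
  as the term \<open>1 / \<rho> ^ 3\<close>. The moments of \<open>|t|^3\<close> and
  \<open>|t|\<close> against the majorant are \<open>9 / v^2\<close> and
  \<open>3 / v\<close>.\<close>

lemma gauss_compare:
  fixes g :: "real \<Rightarrow> complex"
  assumes v: "v > 0" and \<rho>: "\<rho> > 0" and B: "B \<ge> 0" "B' \<ge> 0" and y: "y \<ge> 0"
    and cont: "continuous_on {-pi..pi} g"
    and inner: "\<And>t. \<bar>t\<bar> \<le> \<rho> \<Longrightarrow> \<bar>t\<bar> \<le> pi \<Longrightarrow> norm (g t - exp (- v / 2 * t\<^sup>2)) \<le> (B * \<bar>t\<bar> ^ 3 + B' * \<bar>t\<bar>) * exp (- v / 3 * t\<^sup>2)"
    and outer: "\<And>t. \<rho> < \<bar>t\<bar> \<Longrightarrow> \<bar>t\<bar> \<le> pi \<Longrightarrow> norm (g t) \<le> y"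
  assumes \<rho>_pi: "\<rho> \<le> pi"
  shows "norm (integral {-pi..pi} g - sqrt (2 * pi / v)) \<le> 9 * (B + 1 / \<rho> ^ 3) / v\<^sup>2 + 3 * B' / v + 2 * pi * y"
proof -
  define D where "D = (\<lambda>t. indicator {-pi..pi} t *\<^sub>R g t - of_real (exp (- v / 2 * t\<^sup>2)))"
  define b where "b = (\<lambda>t. (B + 1 / \<rho> ^ 3) * (exp (- (v / 3) * t\<^sup>2) * \<bar>t\<bar> ^ (2 * 1 + 1)) +
     B' * (exp (- (v / 3) * t\<^sup>2) * \<bar>t\<bar> ^ (2 * 0 + 1)) + y * indicator {-pi..pi} t)"
  have set_int: "set_integrable lborel {-pi..pi} g"
    by (rule borel_integrable_compact[OF compact_Icc cont, folded set_integrable_def])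
  have g_int: "has_bochner_integral lborel (\<lambda>t. indicator {-pi..pi} t *\<^sub>R g t) (integral {-pi..pi} g)"
    using set_int set_borel_integral_eq_integral(2)[OF set_int]
    by (simp add: has_bochner_integral_iff set_integrable_def set_lebesgue_integral_def)
  have "has_bochner_integral lborel (\<lambda>t. complex_of_real (exp (- (v / 2) * t\<^sup>2))) (of_real (sqrt (pi / (v / 2))))"
    by (intro has_bochner_integral_of_real has_bochner_integral_gauss) (use v in auto)
  from has_bochner_integral_diff[OF g_int this]
  have D: "has_bochner_integral lborel D (integral {-pi..pi} g - sqrt (2 * pi / v))"
    by (simp add: D_def mult.commute)
  have "has_bochner_integral lborel b ((B + 1 / \<rho> ^ 3) * (fact 1 / (v / 3) ^ Suc 1) + B' * (fact 0 / (v / 3) ^ Suc 0)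
      + y * measure lborel {-pi..pi})"
    unfolding b_def
    by (intro has_bochner_integral_add has_bochner_integral_mult_right has_bochner_integral_gauss(2) has_bochner_integral_real_indicator)
       (use v in auto)
  also have "(B + 1 / \<rho> ^ 3) * (fact 1 / (v / 3) ^ Suc 1) + B' * (fact 0 / (v / 3) ^ Suc 0)
      + y * measure lborel {-pi..pi} = 9 * (B + 1 / \<rho> ^ 3) / v\<^sup>2 + 3 * B' / v + 2 * pi * y"
    by (simp add: power2_eq_square field_simps)
  finally have b: "has_bochner_integral lborel b (9 * (B + 1 / \<rho> ^ 3) / v\<^sup>2 + 3 * B' / v + 2 * pi * y)" .
  have le: "norm (D t) \<le> b t" for t
  proof -
    define E where "E = exp (- (v / 3) * t\<^sup>2)"
    define X where "X = \<bar>t\<bar> ^ 3 * E"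
    have E: "exp (- v / 2 * t\<^sup>2) \<le> E" "E > 0" using v by (auto simp: E_def)
    have X: "X \<ge> 0" "X / \<rho> ^ 3 \<ge> 0" "\<bar>t\<bar> * E \<ge> 0" using E \<rho> by (auto simp: X_def)
    have bt: "b t = B * X + X / \<rho> ^ 3 + B' * (\<bar>t\<bar> * E) + y * indicator {-pi..pi} t"
      unfolding b_def E_def [symmetric] X_def by (simp add: field_simps numeral_3_eq_3)
    have BX: "B * X \<ge> 0" "B' * (\<bar>t\<bar> * E) \<ge> 0" using B X by auto
    show ?thesis
    proof (cases "\<bar>t\<bar> \<le> \<rho>")
      case True
      then have "t \<in> {-pi..pi}" using \<rho>_pi by auto
      then have "norm (D t) = norm (g t - exp (- v / 2 * t\<^sup>2))" by (simp add: D_def)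
      also have "\<dots> \<le> (B * \<bar>t\<bar> ^ 3 + B' * \<bar>t\<bar>) * exp (- v / 3 * t\<^sup>2)"
        by (rule inner) (use True \<rho>_pi in auto)
      also have "\<dots> = B * X + B' * (\<bar>t\<bar> * E)" by (simp add: X_def E_def algebra_simps)
      finally show ?thesis unfolding bt using X y by (simp add: indicator_def)
    next
      case False
      then have "1 \<le> (\<bar>t\<bar> / \<rho>) ^ 3" using \<rho> by (intro one_le_power) auto
      then have "1 * E \<le> (\<bar>t\<bar> / \<rho>) ^ 3 * E" using E by (intro mult_right_mono) auto
      then have EX: "E \<le> X / \<rho> ^ 3" by (simp add: X_def power_divide)
      have "norm (D t) \<le> norm (indicator {-pi..pi} t *\<^sub>R g t) + exp (- v / 2 * t\<^sup>2)"
        unfolding D_def by (rule order_trans[OF norm_triangle_ineq4]) simp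
      also have "norm (indicator {-pi..pi} t *\<^sub>R g t) \<le> y * indicator {-pi..pi} t"
        using outer[of t] False by (auto simp: indicator_def)
      finally show ?thesis unfolding bt using EX E BX by linarith
    qed
  qed
  have "norm (integral\<^sup>L lborel D) \<le> integral\<^sup>L lborel b"
    by (rule Bochner_Integration.integral_norm_bound_integral) (use D b le in \<open>auto simp: has_bochner_integral_iff\<close>)
  then show ?thesis using D b by (simp add: has_bochner_integral_iff)
qed

text \<open>For \<open>|t| <= 1/r\<close> all angles \<open>j * t\<close> are in the range of
  \<open>cos_le\<close>. There the cubic remainder is at most \<open>|t|^3 / 6\<close> times the sum
  of \<open>j^2 * x^j\<close>, hence \<open>r * v / 6 * |t|^3\<close>, and the defect
  \<open>\<mu> - n\<close> leaves \<open>3 * |t|\<close>. The outer decay \<open>y\<close> is a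
  parameter because \<open>r = 1\<close> and \<open>r >= 2\<close> obtain it differently.\<close>

lemma saddle_estimate:
  fixes x y :: real
  assumes r: "r \<ge> 1" and x: "x > 0"
  defines "S \<equiv> (\<Sum>j=1..r. x ^ j / real j)" and "\<mu> \<equiv> (\<Sum>j=1..r. x ^ j)" and "v \<equiv> (\<Sum>j=1..r. real j * x ^ j)"
  assumes \<mu>: "\<bar>\<mu> - real n\<bar> \<le> 3"
    and y: "\<And>t. 1 / real r < \<bar>t\<bar> \<Longrightarrow> \<bar>t\<bar> \<le> pi \<Longrightarrow> y \<le> (\<Sum>j=1..r. x ^ j / real j * (1 - cos (real j * t)))"
  shows "\<bar>2 * pi * x ^ n * exp (- S) * nu n r - sqrt (2 * pi / v)\<bar> \<le> 9 * (real r * v / 6 + real r ^ 3) / v\<^sup>2 + 9 / v + 2 * pi * exp (- y)"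
proof -
  define f where "f = (\<lambda>t. cpoly r (of_real x * cis t) - of_real S + \<i> * of_real (- real n * t))"
  define e where "e = (\<lambda>u::real. iexp u - (1 + \<i> * of_real u - (of_real u)\<^sup>2 / 2))"
  have e: "norm (e u) \<le> \<bar>u\<bar> ^ 3 / 6" for u unfolding e_def by (rule iexp_cubic)
  define g where "g = (\<lambda>t. exp (f t))"
  have v: "v > 0" unfolding v_def using r x by (intro sum_pos) auto
  have S_c: "complex_of_real S = (\<Sum>j=1..r. of_real (x ^ j / real j))" by (simp add: S_def)
  have f_eq: "f t = (\<Sum>j=1..r. of_real (x ^ j / real j) * (iexp (real j * t) - 1)) - \<i> * (real n * t)" for t
  proof -
    have "cpoly r (of_real x * cis t) = (\<Sum>j=1..r. of_real (x ^ j / real j) * iexp (real j * t))"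
      unfolding cpoly_def
    proof (intro sum.cong refl)
      fix j
      have "cis t ^ j = iexp (real j * t)" unfolding Complex.DeMoivre by (rule cis_conv_exp)
      then show "(of_real x * cis t) ^ j / of_nat j = of_real (x ^ j / real j) * iexp (real j * t)"
        by (simp add: power_mult_distrib)
    qed
    then show ?thesis unfolding f_def S_c by (simp add: sum_subtractf algebra_simps)
  qed
  have Re_f: "Re (f t) = - (\<Sum>j=1..r. x ^ j / real j * (1 - cos (real j * t)))" for t
  proof -
    have "Re (f t) = (\<Sum>j=1..r. x ^ j / real j * (cos (real j * t) - 1))"
      unfolding f_eq by (simp add: Re_exp)
    also have "\<dots> = (\<Sum>j=1..r. - (x ^ j / real j * (1 - cos (real j * t))))"
      by (intro sum.cong refl) (simp only: mult_minus_right [symmetric] minus_diff_eq)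
    finally show ?thesis by (simp only: sum_negf)
  qed
  obtain c where c: "((\<lambda>t. exp (cpoly r (of_real x * cis t)) * cis (- real n * t)) has_integral (complex_of_real (2 * pi * x ^ n) * c)) {-pi..pi}"
    "nu n r = Re c" by (rule nu_integral[OF x])
  have "((\<lambda>t. of_real (exp (- S)) * (exp (cpoly r (of_real x * cis t)) * cis (- real n * t))) has_integral
      (of_real (exp (- S)) * (complex_of_real (2 * pi * x ^ n) * c))) {-pi..pi}"
    by (rule has_integral_mult_right[OF c(1)])
  also have "(\<lambda>t. of_real (exp (- S)) * (exp (cpoly r (of_real x * cis t)) * cis (- real n * t))) = g"
    unfolding g_def f_def cis_conv_exp exp_of_real [symmetric] exp_add [symmetric] by (rule ext, rule arg_cong[of _ _ exp]) simp
  finally have int_g: "integral {-pi..pi} g = of_real (2 * pi * x ^ n * exp (- S)) * c"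
    by (simp add: integral_unique mult_ac)
  have jt: "\<bar>real j * t\<bar> \<le> 1" if "j \<in> {1..r}" "\<bar>t\<bar> \<le> 1 / real r" for j t
  proof -
    have "\<bar>real j * t\<bar> \<le> real r * (1 / real r)" unfolding abs_mult using that by (intro mult_mono) auto
    then show ?thesis using r by simp
  qed
  have "norm (integral {-pi..pi} g - sqrt (2 * pi / v))
    \<le> 9 * (real r * v / 6 + 1 / (1 / real r) ^ 3) / v\<^sup>2 + 3 * 3 / v + 2 * pi * exp (- y)"
  proof (rule gauss_compare)
    show "continuous_on {-pi..pi} g" unfolding g_def f_def cpoly_def cis_conv_exp
      by (intro continuous_intros) auto
    have "1 / real r \<le> 1" using r by simp
    then show "1 / real r \<le> pi" using pi_gt3 by linarith
  next
    fix t assume t: "1 / real r < \<bar>t\<bar>" "\<bar>t\<bar> \<le> pi"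
    show "norm (g t) \<le> exp (- y)" unfolding g_def norm_exp_eq_Re Re_f using y[OF t] by simp
  next
    fix t assume t: "\<bar>t\<bar> \<le> 1 / real r"
    define b where "b = complex_of_real (- v / 2 * t\<^sup>2)"
    have vt: "of_real v * z = (\<Sum>j=1..r. of_real (x ^ j / real j) * (of_real (real j ^ 2) * z))" for z :: complex
      unfolding v_def of_real_sum sum_distrib_right by (intro sum.cong refl) (auto simp: power2_eq_square)
    have \<mu>t: "of_real \<mu> * z = (\<Sum>j=1..r. of_real (x ^ j / real j) * (of_real (real j) * z))" for z :: complex
      unfolding \<mu>_def of_real_sum sum_distrib_right by (intro sum.cong refl) auto
    \<comment> \<open>Trades \<open>n\<close> for \<open>\<mu>\<close> in the linear term, so that
      it can be distributed over the summands; the difference is kept as a separate error.\<close>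
    have gen: "A - \<i> * (N * T) + V = A + V - M * (\<i> * T) + \<i> * (M - N) * T" for A V M N T :: complex
      by (simp add: algebra_simps)
    have "f t - b = (\<Sum>j=1..r. of_real (x ^ j / real j) * (iexp (real j * t) - 1)) - \<i> * (real n * t) + of_real v * (of_real (t\<^sup>2 / 2))"
      unfolding f_eq b_def by simp
    also have "\<dots> = (\<Sum>j=1..r. of_real (x ^ j / real j) * (iexp (real j * t) - 1)) + of_real v * (of_real (t\<^sup>2 / 2))
        - of_real \<mu> * (\<i> * t) + \<i> * of_real (\<mu> - real n) * of_real t"
      unfolding of_real_diff of_real_mult by (rule gen)
    also have "(\<Sum>j=1..r. of_real (x ^ j / real j) * (iexp (real j * t) - 1)) + of_real v * (of_real (t\<^sup>2 / 2)) - of_real \<mu> * (\<i> * t)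
      = (\<Sum>j=1..r. of_real (x ^ j / real j) * e (real j * t))"
      unfolding vt \<mu>t sum.distrib [symmetric] sum_subtractf [symmetric]
    proof (intro sum.cong refl)
      fix j
      define c where "c = complex_of_real (x ^ j / real j)"
      define u where "u = real j * t"
      have "of_real (real j ^ 2) * complex_of_real (t\<^sup>2 / 2) = (of_real u)\<^sup>2 / 2"
        by (simp add: u_def power_mult_distrib)
      moreover have "of_real (real j) * (\<i> * complex_of_real t) = \<i> * of_real u" by (simp add: u_def)
      ultimately show "of_real (x ^ j / real j) * (iexp (real j * t) - 1) + of_real (x ^ j / real j) * (of_real (real j ^ 2) * complex_of_real (t\<^sup>2 / 2))
        - of_real (x ^ j / real j) * (of_real (real j) * (\<i> * complex_of_real t)) = of_real (x ^ j / real j) * e (real j * t)"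
        unfolding c_def [symmetric] u_def [symmetric] e_def by (simp add: algebra_simps)
    qed
    finally have fb: "f t - b = (\<Sum>j=1..r. of_real (x ^ j / real j) * e (real j * t))
       + \<i> * of_real (\<mu> - real n) * of_real t" .
    have "norm (f t - b) \<le> (\<Sum>j=1..r. x ^ j / real j * (\<bar>real j * t\<bar> ^ 3 / 6)) + 3 * \<bar>t\<bar>"
      unfolding fb
    proof (rule order_trans[OF norm_triangle_ineq add_mono])
      show "cmod (\<Sum>j=1..r. of_real (x ^ j / real j) * e (real j * t))
        \<le> (\<Sum>j=1..r. x ^ j / real j * (\<bar>real j * t\<bar> ^ 3 / 6))"
      proof (rule sum_norm_le)
        fix j assume "j \<in> {1..r}"
        have "norm (complex_of_real (x ^ j / real j)) = x ^ j / real j" using x by (simp add: norm_divide norm_power)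
        then show "cmod (of_real (x ^ j / real j) * e (real j * t)) \<le> x ^ j / real j * (\<bar>real j * t\<bar> ^ 3 / 6)"
          unfolding norm_mult \<open>norm (complex_of_real (x ^ j / real j)) = x ^ j / real j\<close>
            using x by (intro mult_left_mono e) auto
      qed
      have "cmod (\<i> * of_real (\<mu> - real n) * of_real t) = \<bar>\<mu> - real n\<bar> * \<bar>t\<bar>"
        by (simp only: norm_mult norm_ii norm_of_real mult_1)
      also have "\<dots> \<le> 3 * \<bar>t\<bar>" using \<mu> by (intro mult_right_mono) auto
      finally show "cmod (\<i> * of_real (\<mu> - real n) * of_real t) \<le> 3 * \<bar>t\<bar>" .
    qed
    also have "(\<Sum>j=1..r. x ^ j / real j * (\<bar>real j * t\<bar> ^ 3 / 6)) \<le> (\<Sum>j=1..r. real r / 6 * \<bar>t\<bar> ^ 3 * (real j * x ^ j))"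
    proof (intro sum_mono)
      fix j assume j: "j \<in> {1..r}"
      have "x ^ j / real j * (\<bar>real j * t\<bar> ^ 3 / 6) = real j * (\<bar>t\<bar> ^ 3 / 6 * (real j * x ^ j))"
        using j by (simp add: abs_mult power3_eq_cube)
      also have "\<dots> \<le> real r * (\<bar>t\<bar> ^ 3 / 6 * (real j * x ^ j))"
        using j x by (intro mult_right_mono) auto
      finally show "x ^ j / real j * (\<bar>real j * t\<bar> ^ 3 / 6) \<le> real r / 6 * \<bar>t\<bar> ^ 3 * (real j * x ^ j)" by simp
    qed
    also have "\<dots> = real r * v / 6 * \<bar>t\<bar> ^ 3" unfolding v_def sum_distrib_left [symmetric] by simp
    finally have d: "norm (f t - b) \<le> real r * v / 6 * \<bar>t\<bar> ^ 3 + 3 * \<bar>t\<bar>" by simp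
    have "v * (t\<^sup>2 / 3) \<le> (\<Sum>j=1..r. x ^ j / real j * (1 - cos (real j * t)))"
      unfolding v_def sum_distrib_right
    proof (intro sum_mono)
      fix j assume j: "j \<in> {1..r}"
      have "real j * x ^ j * (t\<^sup>2 / 3) = x ^ j / real j * ((real j * t)\<^sup>2 / 3)"
        using j by (simp add: power2_eq_square)
      also have "\<dots> \<le> x ^ j / real j * (1 - cos (real j * t))"
        using x by (intro mult_left_mono cos_le jt j t) auto
      finally show "real j * x ^ j * (t\<^sup>2 / 3) \<le> x ^ j / real j * (1 - cos (real j * t))" .
    qed
    then have 1: "Re (f t) \<le> - v / 3 * t\<^sup>2" unfolding Re_f by simp
    have 2: "Re b \<le> - v / 3 * t\<^sup>2"
      using v mult_right_mono[of "- v / 2" "- v / 3" "t\<^sup>2"] by (simp add: b_def)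
    have "norm (exp (f t) - exp b) \<le> exp (- v / 3 * t\<^sup>2) * norm (f t - b)"
      by (rule norm_exp_diff_le[OF 1 2])
    also have "\<dots> \<le> exp (- v / 3 * t\<^sup>2) * (real r * v / 6 * \<bar>t\<bar> ^ 3 + 3 * \<bar>t\<bar>)"
      by (intro mult_left_mono d) auto
    finally show "norm (g t - exp (- v / 2 * t\<^sup>2)) \<le> (real r * v / 6 * \<bar>t\<bar> ^ 3 + 3 * \<bar>t\<bar>) * exp (- v / 3 * t\<^sup>2)"
      by (simp only: g_def b_def exp_of_real mult.commute)
  qed (use v r in auto)
  then have "norm (of_real (2 * pi * x ^ n * exp (- S)) * c - sqrt (2 * pi / v))
    \<le> 9 * (real r * v / 6 + real r ^ 3) / v\<^sup>2 + 9 / v + 2 * pi * exp (- y)"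
    unfolding int_g by (simp add: power_divide)
  then have "\<bar>Re (of_real (2 * pi * x ^ n * exp (- S)) * c - sqrt (2 * pi / v))\<bar>
    \<le> 9 * (real r * v / 6 + real r ^ 3) / v\<^sup>2 + 9 / v + 2 * pi * exp (- y)"
    using abs_Re_le_cmod order_trans by blast
  moreover have "Re (of_real (2 * pi * x ^ n * exp (- S)) * c - sqrt (2 * pi / v)) = 2 * pi * x ^ n * exp (- S) * Re c - sqrt (2 * pi / v)"
    by (simp only: minus_complex.simps times_complex.simps Re_complex_of_real Im_complex_of_real)
  ultimately show ?thesis unfolding c(2) by simp
qed

subsection \<open>Stirling's formula and the final estimate\<close>

lemma nu_1: "nu n 1 = 1 / fact n"
proof (rule nu_eq)
  fix n :: nat assume "n > 0"
  then obtain m where "n = Suc m" by (cases n) auto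
  then show "real n * (1 / fact n) = (\<Sum>l=1..min 1 n. 1 / fact (n - l))" by simp
qed simp

lemma cos_le_outer:
  assumes "0 < a" "a \<le> 1" "a < \<bar>t\<bar>" "\<bar>t\<bar> \<le> pi"
  shows "a\<^sup>2 / 3 \<le> 1 - cos t"
proof -
  have "cos \<bar>t\<bar> \<le> cos a" by (rule cos_monotone_0_pi_le) (use assms in auto)
  then show ?thesis using cos_le[of a] assms by simp
qed

text \<open>For \<open>r = 1\<close> and \<open>x = n\<close> the sums \<open>S\<close>,
  \<open>\<mu>\<close> and \<open>v\<close> all equal \<open>n\<close>, and \<open>nu n 1\<close> is
  \<open>1 / fact n\<close>. The total \<open>18 + 9 + 24 = 51\<close> is halved by
  \<open>sqrt (2 * pi) >= 2\<close>.\<close>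

lemma stirling_aux:
  assumes n: "n \<ge> 1"
  shows "\<bar>sqrt (2 * pi * n) * real n ^ n * exp (- real n) / fact n - 1\<bar> \<le> 40 / sqrt n"
proof -
  have "\<bar>2 * pi * real n ^ n * exp (- (\<Sum>j=1..1. real n ^ j / real j)) * nu n 1 - sqrt (2 * pi / (\<Sum>j=1..1. real j * real n ^ j))\<bar>
     \<le> 9 * (real 1 * (\<Sum>j=1..1. real j * real n ^ j) / 6 + real 1 ^ 3) / (\<Sum>j=1..1. real j * real n ^ j)\<^sup>2
       + 9 / (\<Sum>j=1..1. real j * real n ^ j) + 2 * pi * exp (- (n / 3))"
  proof (rule saddle_estimate)
    fix t :: real assume "1 / real 1 < \<bar>t\<bar>" "\<bar>t\<bar> \<le> pi"
    then have "1 / 3 \<le> 1 - cos t" using cos_le_outer[of 1 t] by simp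
    then have "real n * (1 / 3) \<le> real n * (1 - cos t)" by (intro mult_left_mono) auto
    then show "real n / 3 \<le> (\<Sum>j = 1..1. real n ^ j / real j * (1 - cos (real j * t)))" by simp
  qed (use n in auto)
  then have 1: "\<bar>2 * pi * real n ^ n * exp (- real n) / fact n - sqrt (2 * pi / n)\<bar>
     \<le> 9 * (n / 6 + 1) / (real n)\<^sup>2 + 9 / n + 2 * pi * exp (- (n / 3))"
    by (simp add: nu_1 [unfolded One_nat_def])
  have "9 * (n / 6 + 1) / (real n)\<^sup>2 \<le> 9 * (n * 2) / (real n)\<^sup>2"
    using n by (intro divide_right_mono mult_left_mono) auto
  also have "\<dots> = 18 / n" using n by (simp add: power2_eq_square)
  finally have 2: "9 * (n / 6 + 1) / (real n)\<^sup>2 \<le> 18 / n" .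
  have "n / 3 \<le> exp (real n / 3)" using exp_ge_add_one_self[of "real n / 3"] by linarith
  then have "inverse (exp (real n / 3)) \<le> inverse (n / 3)" using n by (intro le_imp_inverse_le) auto
  then have "exp (- (real n / 3)) \<le> 3 / n" by (simp add: exp_minus)
  then have "2 * pi * exp (- (real n / 3)) \<le> 2 * pi * (3 / n)" by (intro mult_left_mono) auto
  also have "\<dots> \<le> 24 / n"
  proof -
    have "pi * 6 \<le> 24" using pi_less_4 by simp
    then show ?thesis using n by (simp add: divide_right_mono mult.commute)
  qed
  finally have 3: "2 * pi * exp (- (real n / 3)) \<le> 24 / n" .
  have 4: "\<bar>2 * pi * real n ^ n * exp (- real n) / fact n - sqrt (2 * pi / n)\<bar> \<le> 51 / n"
  proof -
    have "18 / real n + 9 / n + 24 / n = 51 / n" by (simp add: add_divide_distrib [symmetric])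
    then show ?thesis using 1 2 3 by linarith
  qed
  define P where "P = sqrt (2 * pi)"
  have s: "sqrt n * sqrt n = n" "sqrt n > 0" using n by auto
  have P: "P > 0" "P * P = 2 * pi" by (auto simp: P_def)
  have P2: "P \<ge> 2" unfolding P_def by (rule real_le_rsqrt) (use pi_gt3 in simp)
  have e: "sqrt (2 * pi * n) = P * sqrt n" "sqrt (2 * pi / n) = P / sqrt n"
    unfolding P_def by (rule real_sqrt_mult real_sqrt_divide)+
  have gen: "P * N * A * B / F - 1 = N / P * (P * P * A * B / F - P / N)" if "N > 0" for A B F N :: real
    using that P(1) by (simp add: field_simps)
  have "sqrt (2 * pi * n) * real n ^ n * exp (- real n) / fact n - 1 =
     sqrt n / P * (2 * pi * real n ^ n * exp (- real n) / fact n - sqrt (2 * pi / n))"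
    unfolding e by (rule gen[OF s(2), unfolded P(2)])
  also have "\<bar>\<dots>\<bar> \<le> sqrt n / P * (51 / n)"
    unfolding abs_mult using 4 P by (intro mult_mono) auto
  also have "\<dots> \<le> sqrt n / 2 * (51 / n)" using s P P2 by (intro mult_right_mono divide_left_mono) auto
  also have "\<dots> = (51 / 2) / sqrt n" using s by (simp add: field_simps)
  also have "\<dots> \<le> 40 / sqrt n" by (intro divide_right_mono) auto
  finally show ?thesis .
qed

lemma stirling:
  obtains C where "C > 0" "\<And>n. n \<ge> 1 \<Longrightarrow> \<bar>fact n / (sqrt (2 * pi * n) * real n ^ n * exp (- real n)) - 1\<bar> \<le> C / sqrt n"
proof
  define q where "q = (\<lambda>n. sqrt (2 * pi * real n) * real n ^ n * exp (- real n) / fact n)"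
  \<comment> \<open>\<open>6400 = 80^2\<close> is where \<open>40 / sqrt n\<close> drops to
    \<open>1/2\<close>, so that beyond it \<open>q n\<close> is bounded away from 0 and can be
    inverted; \<open>M\<close> absorbs the finitely many smaller \<open>n\<close>.\<close>
  define M where "M = Max ((\<lambda>n. \<bar>1 / q n - 1\<bar> * sqrt (real n)) ` {..6400})"
  have q_pos: "q n > 0" if "n \<ge> 1" for n using that by (simp add: q_def)
  show "max 80 M > 0" by simp
  fix n :: nat assume n: "n \<ge> 1"
  have "\<bar>1 / q n - 1\<bar> \<le> max 80 M / sqrt n"
  proof (cases "n \<le> 6400")
    case True
    then have "\<bar>1 / q n - 1\<bar> * sqrt n \<le> M" unfolding M_def by (intro Max_ge) auto
    then have "\<bar>1 / q n - 1\<bar> * sqrt n \<le> max 80 M" by simp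
    then show ?thesis using n by (simp add: field_simps)
  next
    case False
    have "sqrt n \<ge> 80" by (rule real_le_rsqrt) (use False in simp)
    then have "40 / sqrt n \<le> 40 / 80" using n by (intro divide_left_mono) auto
    then have "40 / sqrt n \<le> 1 / 2" by simp
    moreover have q1: "\<bar>q n - 1\<bar> \<le> 40 / sqrt n" unfolding q_def by (rule stirling_aux[OF n])
    ultimately have q2: "q n \<ge> 1 / 2" by linarith
    have "\<bar>1 / q n - 1\<bar> = \<bar>q n - 1\<bar> / q n"
      using q_pos[OF n] by (simp add: abs_if field_simps)
    also have "\<dots> \<le> (40 / sqrt n) / (1 / 2)" using q1 q2 q_pos[OF n] by (intro frac_le) auto
    also have "\<dots> = 80 / sqrt n" by simp
    also have "\<dots> \<le> max 80 M / sqrt n" by (intro divide_right_mono) auto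
    finally show ?thesis .
  qed
  then show "\<bar>fact n / (sqrt (2 * pi * n) * real n ^ n * exp (- real n)) - 1\<bar> \<le> max 80 M / sqrt n"
    by (simp add: q_def)
qed

text \<open>\<open>w * x = 1\<close> gives \<open>(1 - w) * x^j = x^j - x^(j-1)\<close>, so the
  first sum telescopes and the second does after summation by parts. The second measures how far the
  sum of \<open>j * x^j\<close> falls short of \<open>r\<close> times the sum of
  \<open>x^j\<close>.\<close>

lemma sum_weighted_power:
  fixes x w :: real
  assumes "w * x = 1"
  shows "(1 - w) * (\<Sum>j=1..r. x ^ j) = x ^ r - 1"
    and "(1 - w) * (\<Sum>j=1..r. (real r - real j) * x ^ j) = (\<Sum>j=1..<r. x ^ j) - (real r - 1) * (if r = 0 then 0 else 1)"
proof -
  have 1: "(1 - w) * (\<Sum>j=1..r. x ^ j) = x ^ r - 1" for r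
  proof (induction r)
    case (Suc r)
    have "(1 - w) * x ^ Suc r = x ^ Suc r - (w * x) * x ^ r" by (simp add: algebra_simps)
    then show ?case using Suc by (simp add: distrib_left assms)
  qed simp
  then show "(1 - w) * (\<Sum>j=1..r. x ^ j) = x ^ r - 1" .
  show "(1 - w) * (\<Sum>j=1..r. (real r - real j) * x ^ j) = (\<Sum>j=1..<r. x ^ j) - (real r - 1) * (if r = 0 then 0 else 1)"
  proof (induction r)
    case (Suc r)
    have "(\<Sum>j=1..Suc r. (real (Suc r) - real j) * x ^ j) = (\<Sum>j=1..r. (real r - real j) * x ^ j + x ^ j)"
      by (simp add: algebra_simps)
    then have "(1 - w) * (\<Sum>j=1..Suc r. (real (Suc r) - real j) * x ^ j) =
       (1 - w) * (\<Sum>j=1..r. (real r - real j) * x ^ j) + (x ^ r - 1)"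
      by (simp add: sum.distrib distrib_left 1 [simplified])
    then show ?case using Suc by (cases r) auto
  qed simp
qed

text \<open>Parallelogram law for \<open>cis a - 1\<close> and \<open>cis b - 1\<close>, since
  \<open>|cis a - 1|^2 = 2 * (1 - cos a)\<close>; the square in the proof is the squared norm of
  their sum.\<close>

lemma cos_diff_le: "1 - cos (a - b) \<le> 2 * (1 - cos a) + 2 * (1 - cos (b::real))"
proof -
  have "2 * (2 * (1 - cos a) + 2 * (1 - cos b) - (1 - cos (a - b))) = (cos a + cos b - 2)\<^sup>2 + (sin a + sin b)\<^sup>2"
  proof -
    have "sin a * sin a = 1 - cos a * cos a" "sin b * sin b = 1 - cos b * cos b"
      using sin_cos_squared_add[of a] sin_cos_squared_add[of b] by (simp_all add: power2_eq_square)
    then show ?thesis unfolding cos_diff by algebra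
  qed
  moreover have "0 \<le> (cos a + cos b - 2)\<^sup>2 + (sin a + sin b)\<^sup>2" by simp
  ultimately have "0 \<le> 2 * (2 * (1 - cos a) + 2 * (1 - cos b) - (1 - cos (a - b)))" by (simp only:)
  then show ?thesis by simp
qed


lemma diff_one_mult_le:
  fixes a b :: real
  assumes "\<bar>a - 1\<bar> \<le> A * t" "\<bar>b - 1\<bar> \<le> B * t" "0 \<le> t" "t \<le> 1" "0 \<le> A" "0 \<le> B"
  shows "\<bar>a * b - 1\<bar> \<le> (A + B + A * B) * t"
proof -
  have gen: "\<bar>p + q + s\<bar> \<le> \<bar>p\<bar> + \<bar>q\<bar> + \<bar>s\<bar>" for p q s :: real by linarith
  have "a * b - 1 = (a - 1) + (b - 1) + (a - 1) * (b - 1)" by (simp add: algebra_simps)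
  then have "\<bar>a * b - 1\<bar> \<le> \<bar>a - 1\<bar> + \<bar>b - 1\<bar> + \<bar>a - 1\<bar> * \<bar>b - 1\<bar>"
    by (simp only: abs_mult [symmetric] gen)
  also have "\<bar>a - 1\<bar> * \<bar>b - 1\<bar> \<le> (A * t) * (B * t)" using assms by (intro mult_mono) auto
  also have "(A * t) * (B * t) \<le> (A * t) * B"
    using assms mult_left_le[of t B] by (intro mult_left_mono) auto
  finally show ?thesis using assms(1,2) by (simp add: algebra_simps)
qed

text \<open>Turns \<open>r <= log n\<close> into bounds of \<open>r\<close> by small powers of
  \<open>n\<close>; used with \<open>k = 12\<close> and \<open>k = 3\<close>.\<close>

lemma ln_le_root: "n \<ge> 1 \<Longrightarrow> k > 0 \<Longrightarrow> ln (real n) \<le> real k * real n powr (1 / real k)"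
proof -
  assume n: "n \<ge> 1" "k > 0"
  have "ln (real n) = real k * ln (real n powr (1 / real k))" using n by (simp add: ln_powr)
  also have "\<dots> \<le> real k * (real n powr (1 / real k) - 1)"
    using n by (intro mult_left_mono ln_le_minus_one) auto
  also have "\<dots> \<le> real k * real n powr (1 / real k)" by (intro mult_left_mono) auto
  finally show ?thesis .
qed

section \<open>The estimates at fixed \<open>n\<close> and \<open>r\<close>\<close>

context
  fixes n r :: nat and t l w x :: real
  assumes r: "r \<ge> 2" and rn: "real r \<le> ln (real n)"
  defines "t \<equiv> real n powr (- 1 / real r)"
  defines "l \<equiv> log_saddle r t"
  defines "w \<equiv> t * exp l"
  defines "x \<equiv> 1 / w"
begin

lemma n_bounds: "n \<ge> 1" "real r \<le> real n" "n > 1"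
proof -
  have "ln (real n) > 0" using r rn by linarith
  then show "n > 1" by (cases "n \<le> 1") (auto simp: le_Suc_eq)
  then show "n \<ge> 1" by simp
  have "ln (real n) \<le> real n" using ln_bound[of "real n"] \<open>n \<ge> 1\<close> by simp
  then show "real r \<le> real n" using rn by simp
qed

lemma t_bounds: "0 < t" "t \<le> exp (-1)" "t \<le> 1"
proof -
  show "0 < t" using n_bounds by (simp add: t_def)
  have "t = exp (- (ln n / r))" using n_bounds by (simp add: t_def powr_def)
  also have "\<dots> \<le> exp (-1)" using rn r by (simp add: field_simps)
  finally show "t \<le> exp (-1)" .
  then show "t \<le> 1" using exp_1_bounds by simp
qed

text \<open>As \<open>r >= 2\<close>, \<open>t\<close> is at least \<open>n powr (-1/2)\<close>;
  thus errors of order \<open>1 / sqrt n\<close>, such as Stirling's, are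
  \<open>O(t)\<close>.\<close>

lemma n_times_t_powers: "real n * t ^ r = 1" "1 / real n \<le> t\<^sup>2" "1 / sqrt n \<le> t"
proof -
  have "t ^ r = real n powr (- 1)" using n_bounds r by (simp add: t_def powr_power)
  then show "real n * t ^ r = 1" using n_bounds by (simp add: powr_minus_divide)
  have "real n powr (-1/2) \<le> t" unfolding t_def using n_bounds r by (intro powr_mono) (auto simp: field_simps)
  moreover have "real n powr (-1/2) = 1 / sqrt n" using n_bounds by (simp add: powr_minus_divide powr_half_sqrt [symmetric])
  ultimately show "1 / sqrt n \<le> t" by simp
  then have "(1 / sqrt n)\<^sup>2 \<le> t\<^sup>2" by (intro power_mono) auto
  then show "1 / real n \<le> t\<^sup>2" by (simp add: power_divide)
qed

lemmas saddle_bounds = log_saddle_saddle[OF r t_bounds(1,2), folded l_def, folded w_def]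

lemma x_equations: "w * x = 1" "x > 1" "x ^ r = real n * (1 - w)"
proof -
  show "w * x = 1" "x > 1" using saddle_bounds(2,3) by (auto simp: x_def)
  have "w ^ r = t ^ r * exp (real r * l)" by (simp add: w_def power_mult_distrib exp_of_nat_mult)
  moreover have "exp (real r * l) = 1 / (1 - w)"
  proof -
    have "exp (real r * l) = inverse (exp (- real r * l))" by (simp add: exp_minus)
    then show ?thesis unfolding saddle_bounds(1) by (simp add: inverse_eq_divide)
  qed
  moreover have "t ^ r = 1 / real n" using n_times_t_powers(1) n_bounds by (simp add: field_simps)
  ultimately show "x ^ r = real n * (1 - w)" by (simp add: x_def power_divide)
qed

lemma first_moment: "\<bar>(\<Sum>j=1..r. x ^ j) - real n\<bar> \<le> 3" "(\<Sum>j=1..r. x ^ j) \<le> n" "real n \<le> (\<Sum>j=1..r. x ^ j) + 3"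
proof -
  have "(1 - w) * (\<Sum>j=1..r. x ^ j) = (1 - w) * real n - 1"
    using sum_weighted_power(1)[OF x_equations(1), of r] x_equations(3) by simp
  then have "(\<Sum>j=1..r. x ^ j) = real n - 1 / (1 - w)" using saddle_bounds(3) by (simp add: field_simps)
  moreover have "0 < 1 / (1 - w)" using saddle_bounds(3) by simp
  moreover have "1 / (1 - w) \<le> 1 / (1/3)" using saddle_bounds(3) by (intro divide_left_mono) auto
  ultimately show "\<bar>(\<Sum>j=1..r. x ^ j) - real n\<bar> \<le> 3" "(\<Sum>j=1..r. x ^ j) \<le> n" "real n \<le> (\<Sum>j=1..r. x ^ j) + 3" by auto
qed

text \<open>The top term \<open>r * x^r = r * n * (1 - w)\<close> alone gives the lower bound. The
  deficit is \<open>r * (n - \<mu>) + A\<close>; multiplied by \<open>1 - w\<close>,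
  \<open>A\<close> is at most a sum of powers below \<open>x^r\<close>, which is \<open>w\<close>
  times a sum not exceeding \<open>n\<close>. Hence \<open>A = O(t * n)\<close>.\<close>

lemma second_moment:
  defines "v \<equiv> (\<Sum>j=1..r. real j * x ^ j)"
  shows "real r * n / 3 \<le> v" "v \<le> real r * n" "real r * n - v \<le> 6 * t * (real r * n)"
proof -
  define \<mu> where "\<mu> = (\<Sum>j=1..r. x ^ j)"
  define A where "A = (\<Sum>j=1..r. (real r - real j) * x ^ j)"
  have "real r * n / 3 \<le> real r * (real n * (1 - w))"
    using saddle_bounds(3) mult_left_mono[of "1/3" "1 - w" "real r * n"] by (simp add: mult.assoc)
  also have "\<dots> = real r * x ^ r" by (simp add: x_equations(3))
  also have "\<dots> \<le> v" unfolding v_def using x_equations(2) r by (intro member_le_sum) auto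
  finally show "real r * n / 3 \<le> v" .
  have vA: "real r * \<mu> - v = A"
    by (simp add: \<mu>_def v_def A_def sum_distrib_left sum_subtractf left_diff_distrib)
  have A0: "A \<ge> 0" unfolding A_def using x_equations(2) by (intro sum_nonneg) auto
  have "v \<le> real r * \<mu>" using vA A0 by simp
  also have "\<dots> \<le> real r * n" using first_moment(2) by (intro mult_left_mono) (auto simp: \<mu>_def)
  finally show "v \<le> real r * n" .
  have "(1 - w) * A \<le> (\<Sum>j=1..<r. x ^ j)"
    unfolding A_def sum_weighted_power(2)[OF x_equations(1)] using r by simp
  also have "\<dots> = w * (\<Sum>j=1..<r. x ^ Suc j)"
    using x_equations(1) by (simp add: sum_distrib_left mult.assoc [symmetric])
  also have "(\<Sum>j=1..<r. x ^ Suc j) = (\<Sum>j=2..r. x ^ j)"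
    by (rule sum.reindex_bij_witness[of _ "\<lambda>j. j - 1" Suc]) auto
  also have "\<dots> \<le> \<mu>" unfolding \<mu>_def using x_equations(2) by (intro sum_mono2) auto
  also have "\<mu> \<le> n" using first_moment(2) by (simp add: \<mu>_def)
  finally have "(1 - w) * A \<le> w * n" using saddle_bounds(2) by (simp add: mult_left_mono)
  moreover have "(1/3) * A \<le> (1 - w) * A" using saddle_bounds(3) A0 by (intro mult_right_mono) auto
  ultimately have "A \<le> 3 * (w * n)" by linarith
  also have "\<dots> \<le> 3 * (2 * t * n)" using saddle_bounds(5) by (intro mult_left_mono mult_right_mono) auto
  finally have A1: "A \<le> 6 * t * n" by simp
  have "real r * n - v = real r * (n - \<mu>) + A" using vA by (simp add: algebra_simps)
  also have "\<dots> \<le> real r * 3 + 6 * t * n" using first_moment(3) A1 by (intro add_mono mult_left_mono) (auto simp: \<mu>_def)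
  also have "\<dots> \<le> real r * (3 * (t * n)) + real r * (3 * t * n)"
  proof (intro add_mono mult_left_mono)
    have "1 / real n * n \<le> t\<^sup>2 * n" using n_times_t_powers(2) by (intro mult_right_mono) auto
    also have "\<dots> \<le> t * n" using t_bounds by (intro mult_right_mono) (auto simp: power2_eq_square mult_left_le)
    finally show "3 \<le> 3 * (t * n)" using n_bounds by simp
    have "2 * (3 * t * n) \<le> real r * (3 * t * n)" using r t_bounds by (intro mult_right_mono) auto
    then show "6 * t * n \<le> real r * (3 * t * n)" by simp
  qed auto
  finally show "real r * n - v \<le> 6 * t * (real r * n)" by (simp add: algebra_simps)
qed


text \<open>The terms \<open>j = r\<close> and \<open>j = r - 1\<close> suffice: \<open>r * \<theta>\<close> and \<open>(r - 1) * \<theta>\<close> cannot both be close to multiples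
  of \<open>2 * pi\<close>, as their difference \<open>\<theta>\<close> is not.\<close>
lemma outer_bound:
  assumes \<theta>: "1 / real r < \<bar>\<theta>\<bar>" "\<bar>\<theta>\<bar> \<le> pi"
  shows "real n * t / (18 * real r ^ 3) \<le> (\<Sum>j=1..r. x ^ j / real j * (1 - cos (real j * \<theta>)))"
proof -
  define c where "c = (\<lambda>j. 1 - cos (real j * \<theta>))"
  have c: "c j \<ge> 0" for j by (simp add: c_def)
  \<comment> \<open>\<open>x^(r-1) = w * x^r = n * w * (1 - w)\<close> is at least
    \<open>n * t / 3\<close>. Both weights are lowered to \<open>x^(r-1) / r\<close> below, which
    gives \<open>18 = 3 * 6\<close>.\<close>
  have "real n * t * (1/3) \<le> real n * w * (1 - w)"
    using saddle_bounds(2,3,4) t_bounds by (intro mult_mono) auto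
  also have "\<dots> = w * x ^ r" by (simp add: x_equations(3))
  also have "\<dots> = x ^ (r - 1)" using x_equations(1) r by (cases r) (simp_all add: mult.assoc [symmetric])
  finally have xr: "real n * t / 3 \<le> x ^ (r - 1)" by simp
  have "(1 / real r)\<^sup>2 / 3 \<le> 1 - cos \<theta>"
    by (rule cos_le_outer) (use \<theta> r in auto)
  also have "\<theta> = real r * \<theta> - real (r - 1) * \<theta>" using r by (simp add: of_nat_diff algebra_simps)
  also have "1 - cos \<dots> \<le> 2 * c r + 2 * c (r - 1)" unfolding c_def by (rule cos_diff_le)
  finally have "1 / (6 * real r ^ 2) \<le> c r + c (r - 1)" by (simp add: power_divide)
  then have "real n * t / 3 / real r * (1 / (6 * real r ^ 2)) \<le> x ^ (r - 1) / real r * (c r + c (r - 1))"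
    using xr t_bounds x_equations(2) by (intro mult_mono divide_right_mono) auto
  also have "\<dots> = x ^ (r - 1) / real r * c r + x ^ (r - 1) / real r * c (r - 1)" by (rule distrib_left)
  also have "\<dots> \<le> x ^ r / real r * c r + x ^ (r - 1) / real (r - 1) * c (r - 1)"
    using x_equations(2) r c by (intro add_mono mult_right_mono divide_right_mono divide_left_mono power_increasing) auto
  also have "\<dots> = (\<Sum>j\<in>{r, r - 1}. x ^ j / real j * c j)" using r by (subst sum.insert) auto
  also have "\<dots> \<le> (\<Sum>j=1..r. x ^ j / real j * c j)"
    using r x_equations(2) c by (intro sum_mono2) auto
  finally show ?thesis unfolding c_def by (simp add: power2_eq_square power3_eq_cube mult_ac)
qed

text \<open>Any exponent below \<open>1/2\<close> would serve, because the outer decay has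
  \<open>n * t >= sqrt n\<close> against \<open>r^3\<close>. The constant is
  \<open>12^3\<close>.\<close>

lemma r_cubed_le: "real r ^ 3 \<le> 1728 * real n powr (1/4)"
proof -
  have "real r \<le> 12 * real n powr (1/12)"
    using rn ln_le_root[OF n_bounds(1), of 12] by simp
  then have "real r ^ 3 \<le> (12 * real n powr (1/12)) ^ 3" by (intro power_mono) auto
  also have "\<dots> = 1728 * real n powr (1/4)" using n_bounds by (simp add: power_mult_distrib powr_power)
  finally show ?thesis .
qed

text \<open>\<open>n * t >= sqrt n\<close> and \<open>r_cubed_le\<close> bound the exponent below by
  \<open>n powr (1/4) / 31104\<close>, where \<open>31104 = 18 * 1728\<close>; then
  \<open>exp y >= (y / 4)^4\<close> yields a full power of \<open>n\<close>, with
  \<open>256 = 4^4\<close>.\<close>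

lemma outer_exp_le: "exp (- (real n * t / (18 * real r ^ 3))) \<le> 256 * 31104 ^ 4 / real n"
proof -
  define q where "q = real n powr (1/4)"
  have q: "q > 0" "q ^ 4 = n" "q * q = sqrt n"
    using n_bounds by (auto simp: q_def powr_power powr_half_sqrt [symmetric] powr_add [symmetric])
  define y where "y = real n * t / (18 * real r ^ 3)"
  have "real n * (1 / sqrt n) \<le> real n * t" using n_times_t_powers(3) by (intro mult_left_mono) auto
  then have "q * q \<le> real n * t" unfolding q(3) using n_bounds by (simp add: real_div_sqrt)
  then have "q * q / (18 * (1728 * q)) \<le> y"
    unfolding y_def using r_cubed_le r q n_bounds t_bounds by (intro frac_le) (auto simp: q_def)
  then have y: "q / 31104 \<le> y" using q(1) by simp
  have "q / 31104 / 4 \<le> y / 4" using y by simp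
  also have "\<dots> \<le> exp (y / 4)" using exp_ge_add_one_self[of "y / 4"] by linarith
  finally have "(q / 31104 / 4) ^ 4 \<le> exp (y / 4) ^ 4" using q by (intro power_mono) auto
  also have "exp (y / 4) ^ 4 = exp y" by (simp flip: exp_of_nat_mult)
  finally have "inverse (exp y) \<le> inverse ((q / 31104 / 4) ^ 4)" using q by (intro le_imp_inverse_le) auto
  also have "\<dots> = 256 * 31104 ^ 4 / real n" by (simp add: power_divide q(2))
  finally show ?thesis by (simp add: y_def exp_minus)
qed

text \<open>Normalisation multiplies the absolute error \<open>O(1 / n)\<close> by
  \<open>sqrt (r * n)\<close>. The claim amounts to \<open>r <= 4 * n * t^2\<close>: for
  \<open>r >= 3\<close> one has \<open>n * t^2 >= n powr (1/3)\<close> and \<open>ln_le_root\<close>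
  suffices, while for \<open>r = 2\<close> the right side is exactly 4.\<close>

lemma sqrt_r_n: "sqrt (real r * n) / n \<le> 2 * t"
proof -
  have "real r \<le> 4 * (n * t\<^sup>2)"
  proof (cases "r = 2")
    case True
    then show ?thesis using n_times_t_powers(1) by simp
  next
    case False
    have "real r \<le> 3 * real n powr (1/3)" using rn ln_le_root[OF n_bounds(1), of 3] by simp
    also have "real n powr (1/3) = real n powr 1 * real n powr (- 2/3)"
      unfolding powr_add [symmetric] by simp
    also have "\<dots> \<le> n * t\<^sup>2"
    proof -
      have "t\<^sup>2 = real n powr (- 2 / real r)" using n_bounds by (simp add: t_def powr_power)
      moreover have "real n powr (- 2/3) \<le> real n powr (- 2 / real r)"
        using n_bounds r False by (intro powr_mono) (auto simp: field_simps)
      ultimately show ?thesis using n_bounds by (simp add: mult_left_mono)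
    qed
    finally show ?thesis by simp
  qed
  then have "real r * n \<le> 4 * (n * t\<^sup>2) * n" by (intro mult_right_mono) auto
  also have "\<dots> = (2 * t * n)\<^sup>2" by (simp add: power2_eq_square)
  finally have "sqrt (real r * n) \<le> 2 * t * n" using t_bounds by (intro real_le_lsqrt) auto
  then show ?thesis using n_bounds by (simp add: divide_le_eq)
qed

text \<open>\<open>113\<close> rounds up \<open>9/2 + 81 + 27\<close>, \<open>K\<close> comes from
  the outer arc, and \<open>18\<close> from replacing \<open>v\<close> by \<open>r * n\<close> in
  the main term; the factor 2 is that of \<open>sqrt_r_n\<close>.\<close>

lemma nu_saddle:
  defines "S \<equiv> (\<Sum>j=1..r. x ^ j / real j)"
  shows "\<bar>sqrt (2 * pi * (real r * n)) * x ^ n * exp (- S) * nu n r - 1\<bar> \<le> (2 * (113 + 8 * (256 * 31104 ^ 4)) + 18) * t"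
proof -
  define v where "v = (\<Sum>j=1..r. real j * x ^ j)"
  define M where "M = real r * n"
  define K :: real where "K = 256 * 31104 ^ 4"
  have M: "M > 0" using r n_bounds by (simp add: M_def)
  have v: "M / 3 \<le> v" "v \<le> M" "M - v \<le> 6 * t * M" "v > 0"
    using second_moment M by (auto simp: v_def M_def)
  have "\<bar>2 * pi * x ^ n * exp (- S) * nu n r - sqrt (2 * pi / v)\<bar> \<le> 9 * (real r * v / 6 + real r ^ 3) / v\<^sup>2 + 9 / v + 2 * pi * exp (- (real n * t / (18 * real r ^ 3)))"
    unfolding S_def v_def by (rule saddle_estimate) (use r x_equations first_moment outer_bound in auto)
  also have "\<dots> \<le> (9/2 / n + 81 / n) + 27 / n + 8 * (K / n)"
  proof (intro add_mono)
    have iv: "1 / v \<le> 3 / M" using v M by (simp add: field_simps)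
    have rM: "real r * (3 / M) = 3 / n" using r by (simp add: M_def)
    have "9 * (real r * v / 6 + real r ^ 3) / v\<^sup>2 = 3/2 * (real r * (1 / v)) + 9 * real r * (real r * (1 / v))\<^sup>2"
      using v(4) by (simp add: field_simps power2_eq_square power3_eq_cube)
    also have "\<dots> \<le> 3/2 * (3 / n) + 9 * real r * (3 / n)\<^sup>2"
    proof (intro add_mono mult_left_mono power_mono)
      show 1: "real r * (1 / v) \<le> 3 / n" using mult_left_mono[OF iv, of "real r"] rM by simp
      show "real r * (1 / v) \<le> 3 / n" by fact
    qed (use v in auto)
    also have "9 * real r * (3 / n)\<^sup>2 \<le> 9 * real n * (3 / n)\<^sup>2"
      using n_bounds by (intro mult_right_mono) auto
    also have "9 * real n * (3 / n)\<^sup>2 = 81 / n" using n_bounds by (simp add: power2_eq_square)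
    finally show "9 * (real r * v / 6 + real r ^ 3) / v\<^sup>2 \<le> 9/2 / n + 81 / n" by simp
    have "9 / v \<le> 27 / M" using iv by (simp add: field_simps)
    also have "\<dots> \<le> 27 / n" unfolding M_def using r n_bounds by (intro divide_left_mono) auto
    finally show "9 / v \<le> 27 / n" .
    show "2 * pi * exp (- (real n * t / (18 * real r ^ 3))) \<le> 8 * (K / n)"
      unfolding K_def using outer_exp_le pi_less_4 by (intro mult_mono) auto
  qed
  also have "\<dots> \<le> (113 + 8 * K) / n" using n_bounds by (simp add: field_simps)
  finally have 1: "\<bar>2 * pi * x ^ n * exp (- S) * nu n r - sqrt (2 * pi / v)\<bar> \<le> (113 + 8 * K) / n" .
  define P where "P = sqrt (2 * pi)"
  have P: "P > 0" "P * P = 2 * pi" by (auto simp: P_def)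
  have P2: "P \<ge> 1" unfolding P_def by (rule real_le_rsqrt) (use pi_gt3 in simp)
  have e: "sqrt (2 * pi * M) = P * sqrt M" "sqrt (2 * pi / v) = P / sqrt v"
    unfolding P_def by (rule real_sqrt_mult real_sqrt_divide)+
  have "P * sqrt M * x ^ n * exp (- S) * nu n r - sqrt M / sqrt v = sqrt M / P * (P * P * x ^ n * exp (- S) * nu n r - P / sqrt v)"
    using P(1) v(4) by (simp add: field_simps)
  also have "\<bar>\<dots>\<bar> \<le> sqrt M / 1 * ((113 + 8 * K) / n)"
    unfolding abs_mult using 1 P P2 M by (intro mult_mono) (auto simp: e(2) divide_left_mono mult.assoc divide_le_eq mult_ge1_I K_def)
  also have "\<dots> = (113 + 8 * K) * (sqrt M / n)" by simp
  also have "\<dots> \<le> (113 + 8 * K) * (2 * t)" using sqrt_r_n by (intro mult_left_mono) (auto simp: M_def K_def)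
  finally have 2: "\<bar>P * sqrt M * x ^ n * exp (- S) * nu n r - sqrt M / sqrt v\<bar> \<le> (113 + 8 * K) * (2 * t)" .
  define z where "z = M / v"
  have z: "z \<ge> 1" using v by (simp add: z_def)
  have "sqrt z \<ge> 1" using z by simp
  moreover have "sqrt z \<le> z" using z by (intro real_le_lsqrt) (auto simp: power2_eq_square)
  moreover have "z - 1 = (M - v) / v" using v(4) by (simp add: z_def field_simps)
  moreover have "(M - v) / v \<le> (6 * t * M) / (M / 3)" using v M t_bounds by (intro frac_le) auto
  moreover have "(6 * t * M) / (M / 3) = 18 * t" using M by simp
  ultimately have "\<bar>sqrt z - 1\<bar> \<le> 18 * t" by linarith
  moreover have "sqrt z = sqrt M / sqrt v" by (simp add: z_def real_sqrt_divide)
  ultimately have "\<bar>P * sqrt M * x ^ n * exp (- S) * nu n r - 1\<bar> \<le> (113 + 8 * K) * (2 * t) + 18 * t"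
    using 2 by linarith
  then show ?thesis unfolding M_def [symmetric] e K_def by (simp only: algebra_simps)
qed

text \<open>The exponent series is multiplied by \<open>n\<close>, and \<open>n * t^r = 1\<close>
  turns its \<open>t^r\<close> terms into constants. The remainder \<open>u\<close> collects the
  tail, at most \<open>200 * t\<close>, and the compensating term \<open>(r + 1) * l\<close>, at
  most \<open>6 * t + 6 * t / r <= 9 * t\<close>.\<close>

lemma exponent_expansion:
  defines "S \<equiv> (\<Sum>j=1..r. x ^ j / real j)"
  shows "\<exists>u. \<bar>u\<bar> \<le> 209 * t \<and> S + real n * l = real n / real r + d r r + (\<Sum>N=1..<r. d r N * (real n * t ^ N)) + u"
proof -
  obtain E where E: "\<bar>E\<bar> \<le> 200 * t" "(\<lambda>N. exponent_coeff r N * t ^ N) sums ((\<Sum>N=1..<r. exponent_coeff r N * t ^ N) + t ^ r * E)"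
    using exponent_coeff_tail[OF r t_bounds(1,2)] by blast
  define H where "H = (\<Sum>j=2..r. 1 / real j)"
  have t': "\<bar>t\<bar> < 5/13" using t_bounds exp_1_bounds by simp
  have "(\<Sum>N=1..<r. exponent_coeff r N * t ^ N) + t ^ r * E =
     (\<Sum>j=1..r. 1 / real j * t ^ (r - j) * exp (- real j * l)) - (real r + 1) * t ^ r * l + l - 1 / real r + 1 / real r * H * t ^ r"
    using sums_unique2[OF E(2) exponent_coeff_sums[OF r t']] by (simp add: l_def H_def)
  also have "(\<Sum>j=1..r. 1 / real j * t ^ (r - j) * exp (- real j * l)) = t ^ r * S"
    unfolding S_def sum_distrib_left
  proof (intro sum.cong refl)
    fix j assume j: "j \<in> {1..r}"
    have "x ^ j = exp (- real j * l) / t ^ j"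
      unfolding x_def w_def by (simp add: power_divide power_mult_distrib exp_minus field_simps flip: exp_of_nat_mult)
    moreover have "t ^ r = t ^ (r - j) * t ^ j" using j by (simp flip: power_add)
    ultimately show "1 / real j * t ^ (r - j) * exp (- real j * l) = t ^ r * (x ^ j / real j)"
      using t_bounds by simp
  qed
  finally have "real n * ((\<Sum>N=1..<r. exponent_coeff r N * t ^ N) + t ^ r * E) =
     real n * (t ^ r * S - (real r + 1) * t ^ r * l + l - 1 / real r + 1 / real r * H * t ^ r)" by simp
  also have "\<dots> = (real n * t ^ r) * S - (real r + 1) * (real n * t ^ r) * l + real n * l - real n / real r + 1 / real r * H * (real n * t ^ r)"
    by (simp add: algebra_simps)
  also have "\<dots> = S - (real r + 1) * l + real n * l - real n / real r + 1 / real r * H" unfolding n_times_t_powers(1) by simp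
  finally have "S + real n * l = real n / real r - 1 / real r * H + real n * ((\<Sum>N=1..<r. exponent_coeff r N * t ^ N) + t ^ r * E) + (real r + 1) * l"
    by simp
  also have "real n * ((\<Sum>N=1..<r. exponent_coeff r N * t ^ N) + t ^ r * E) = (\<Sum>N=1..<r. real n * (exponent_coeff r N * t ^ N)) + (real n * t ^ r) * E"
    by (simp add: distrib_left sum_distrib_left)
  also have "(\<Sum>N=1..<r. real n * (exponent_coeff r N * t ^ N)) = (\<Sum>N=1..<r. d r N * (real n * t ^ N))"
    by (intro sum.cong refl) (auto simp: exponent_coeff_def[OF r] log_saddle_coeff_d)
  finally have eq: "S + real n * l = real n / real r - 1 / real r * H + ((\<Sum>N=1..<r. d r N * (real n * t ^ N)) + E) + (real r + 1) * l"
    unfolding n_times_t_powers(1) by simp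
  have "0 \<le> (real r + 1) * l" using saddle_bounds(6) by simp
  moreover have "(real r + 1) * l \<le> (real r + 1) * (6 * t / r)" using saddle_bounds(7) by (intro mult_left_mono) auto
  moreover have "(real r + 1) * (6 * t / r) = 6 * t + 6 * t / r" using r by (simp add: field_simps)
  moreover have "6 * t / r \<le> 6 * t / 2" using r t_bounds by (intro divide_left_mono) auto
  ultimately have "\<bar>E + (real r + 1) * l\<bar> \<le> 209 * t" using E(1) by linarith
  moreover have "d r r = - (1 / real r * H)" using r by (simp add: d_def H_def)
  ultimately show ?thesis using eq by (intro exI[of _ "E + (real r + 1) * l"]) simp
qed


lemma sum_d_powr:
  "(\<Sum>N=0..r. d r N * real n powr ((real r - real N) / real r)) =
     (- 1 + 1 / real r) * real n + d r r + (\<Sum>N=1..<r. d r N * (real n * t ^ N))"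
proof -
  have p: "real n powr ((real r - real N) / real r) = real n * t ^ N" for N
  proof -
    have "(real r - real N) / real r = 1 + real N * (- 1 / real r)" using r by (simp add: field_simps)
    then have "real n powr ((real r - real N) / real r) = real n powr 1 * real n powr (real N * (- 1 / real r))"
      by (simp only: powr_add)
    also have "real n powr (real N * (- 1 / real r)) = t ^ N"
      unfolding t_def using n_bounds by (intro powr_power [symmetric]) simp
    finally show ?thesis by simp
  qed
  have "{0..r} = insert 0 (insert r {1..<r})" using r by auto
  then have "(\<Sum>N=0..r. d r N * (real n * t ^ N)) =
     d r 0 * (real n * t ^ 0) + (d r r * (real n * t ^ r) + (\<Sum>N=1..<r. d r N * (real n * t ^ N)))"
    using r by simp
  then show ?thesis unfolding p n_times_t_powers(1) by (simp add: d_def)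
qed

text \<open>Three relative errors multiply: \<open>s\<close> from Stirling, \<open>Q\<close> from
  the circle and \<open>exp u\<close> from the exponent. As \<open>t <= 1\<close>, \<open>u\<close>
  is at most 209 in absolute value, so the exponential has Lipschitz constant \<open>exp 209\<close>
  there.\<close>

lemma fact_nu_expansion:
  assumes C: "C \<ge> 0" "\<And>n. n \<ge> 1 \<Longrightarrow> \<bar>fact n / (sqrt (2 * pi * n) * real n ^ n * exp (- real n)) - 1\<bar> \<le> C / sqrt n"
  defines "B \<equiv> 2 * (113 + 8 * (256 * 31104 ^ 4)) + 18"
  defines "B' \<equiv> B + 209 * exp 209 + B * (209 * exp 209)"
  shows "\<exists>\<epsilon>::real. \<bar>\<epsilon>\<bar> \<le> (C + B' + C * B') * t \<and>
        fact n * nu n r = 1 / sqrt (real r) * real n powr (real n * (1 - 1 / real r))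
            * exp (\<Sum>N=0..r. d r N * real n powr ((real r - real N) / real r)) * (1 + \<epsilon>)"
proof -
  define S where "S = (\<Sum>j=1..r. x ^ j / real j)"
  define Q where "Q = sqrt (2 * pi * (real r * n)) * x ^ n * exp (- S) * nu n r"
  define s where "s = fact n / (sqrt (2 * pi * n) * real n ^ n * exp (- real n))"
  obtain u where u: "\<bar>u\<bar> \<le> 209 * t" "S + real n * l = real n / real r + d r r + (\<Sum>N=1..<r. d r N * (real n * t ^ N)) + u"
    using exponent_expansion unfolding S_def by blast
  have s1: "\<bar>s - 1\<bar> \<le> C * t"
  proof -
    have "\<bar>s - 1\<bar> \<le> C * (1 / sqrt n)" unfolding s_def using C(2)[OF n_bounds(1)] by simp
    also have "\<dots> \<le> C * t" using n_times_t_powers(3) C(1) by (rule mult_left_mono)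
    finally show ?thesis .
  qed
  have Q1: "\<bar>Q - 1\<bar> \<le> B * t" unfolding Q_def S_def B_def by (rule nu_saddle)
  have u1: "\<bar>exp u - 1\<bar> \<le> 209 * exp 209 * t"
  proof -
    have "exp (complex_of_real u) - exp 0 = of_real (exp u - 1)" by (simp add: exp_of_real)
    then have "\<bar>exp u - 1\<bar> = norm (exp (complex_of_real u) - exp 0)" by (simp only: norm_of_real)
    also have "\<dots> \<le> exp \<bar>u\<bar> * norm (complex_of_real u - 0)" by (rule norm_exp_diff_le) auto
    also have "\<dots> \<le> exp 209 * (209 * t)" using u(1) t_bounds by (intro mult_mono) auto
    finally show ?thesis by simp
  qed
  have B: "B \<ge> 0" by (simp add: B_def)
  have QE: "\<bar>Q * exp u - 1\<bar> \<le> B' * t" unfolding B'_def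
    by (rule diff_one_mult_le[OF Q1 u1]) (use t_bounds B in auto)
  have sQE: "\<bar>s * (Q * exp u) - 1\<bar> \<le> (C + B' + C * B') * t"
    by (rule diff_one_mult_le[OF s1 QE]) (use t_bounds B C in \<open>auto simp: B'_def\<close>)
  define X where "X = (\<Sum>N=0..r. d r N * real n powr ((real r - real N) / real r))"
  have X: "X + u = S + real n * l - real n"
    unfolding X_def sum_d_powr u(2) by (simp add: algebra_simps)
  have nt: "real n powr (real n * (1 - 1 / real r)) = real n ^ n * t ^ n"
  proof -
    have "real n * (1 - 1 / real r) = real n + real n * (- 1 / real r)" by (simp add: algebra_simps)
    then have "real n powr (real n * (1 - 1 / real r)) = real n powr real n * real n powr (real n * (- 1 / real r))"
      by (simp only: powr_add)
    also have "real n powr (real n * (- 1 / real r)) = t ^ n"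
      unfolding t_def using n_bounds by (intro powr_power [symmetric]) simp
    also have "real n powr real n = real n ^ n" using n_bounds by (intro powr_realpow) simp
    finally show ?thesis .
  qed
  have xn: "x ^ n = 1 / (t ^ n * exp (real n * l))"
    by (simp add: x_def w_def power_divide power_mult_distrib exp_of_nat_mult)
  \<comment> \<open>Groups the factors that cancel: \<open>t^n * exp (n * l)\<close> with
    \<open>x^n\<close>, \<open>exp S\<close> with \<open>exp (- S)\<close>, and the square roots
    with each other; what remains is \<open>fact n * nu n r\<close>.\<close>
  have gen: "1 / R * (A * T) * (E * L * F) * s * (V * Y * G * z) = (s * (W * A * F)) * z * ((T * L) * Y) * (E * G) * (V / (R * W))"
    if "R \<noteq> 0" "W \<noteq> 0" for R A T E L F s V Y G z W :: real
    using that by (simp add: field_simps)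
  have "1 / sqrt (real r) * (real n ^ n * t ^ n) * exp X * (s * (Q * exp u)) =
     1 / sqrt (real r) * (real n ^ n * t ^ n) * exp (X + u) * s * Q"
    unfolding exp_add by (simp only: mult_ac)
  also have "exp (X + u) = exp S * exp (real n * l) * exp (- real n)"
    unfolding X exp_add [symmetric] by simp
  also have "1 / sqrt (real r) * (real n ^ n * t ^ n) * (exp S * exp (real n * l) * exp (- real n)) * s * Q
    = (s * (sqrt (2 * pi * n) * real n ^ n * exp (- real n))) * nu n r
      * ((t ^ n * exp (real n * l)) * x ^ n) * (exp S * exp (- S)) * (sqrt (2 * pi * (real r * n)) / (sqrt (real r) * sqrt (2 * pi * n)))"
    unfolding Q_def by (rule gen) (use r n_bounds in auto)
  also have "exp S * exp (- S) = 1" by (simp flip: exp_add)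
  also have "(t ^ n * exp (real n * l)) * x ^ n = 1" unfolding xn using t_bounds by simp
  also have "sqrt (2 * pi * (real r * n)) / (sqrt (real r) * sqrt (2 * pi * n)) = 1"
    using r n_bounds by (simp add: real_sqrt_mult)
  also have "s * (sqrt (2 * pi * n) * real n ^ n * exp (- real n)) = fact n"
    unfolding s_def using n_bounds by simp
  finally have "fact n * nu n r = 1 / sqrt (real r) * (real n ^ n * t ^ n) * exp X * (s * (Q * exp u))" by simp
  then show ?thesis using sQE unfolding nt X_def
    by (intro exI[of _ "s * (Q * exp u) - 1"]) simp
qed

end

theorem theorem1:
  shows "\<exists>C::real. C > 0 \<and>
    (\<forall>n r :: nat. 2 \<le> r \<and> real r \<le> ln (real n) \<longrightarrow>
      (\<exists>\<epsilon>::real. \<bar>\<epsilon>\<bar> \<le> C * real n powr (- 1 / real r) \<and>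
        fact n * nu n r =
          1 / sqrt (real r) * real n powr (real n * (1 - 1 / real r))
            * exp (\<Sum>N=0..r. d r N * real n powr ((real r - real N) / real r))
            * (1 + \<epsilon>)))"
proof -
  obtain C where C: "C > 0" "\<And>n. n \<ge> 1 \<Longrightarrow> \<bar>fact n / (sqrt (2 * pi * n) * real n ^ n * exp (- real n)) - 1\<bar> \<le> C / sqrt n"
    using stirling by blast
  define B B' where "B = 2 * (113 + 8 * (256 * 31104 ^ 4)) + (18 :: real)"
    and "B' = B + 209 * exp 209 + B * (209 * exp 209)"
  have "C + B' + C * B' > 0" using C(1) by (auto simp: B_def B'_def intro!: add_pos_nonneg)
  moreover have "\<exists>\<epsilon>::real. \<bar>\<epsilon>\<bar> \<le> (C + B' + C * B') * real n powr (- 1 / real r) \<and>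
        fact n * nu n r = 1 / sqrt (real r) * real n powr (real n * (1 - 1 / real r))
            * exp (\<Sum>N=0..r. d r N * real n powr ((real r - real N) / real r)) * (1 + \<epsilon>)"
    if "2 \<le> r \<and> real r \<le> ln (real n)" for n r
    using fact_nu_expansion[of r n C] that C unfolding B'_def B_def by auto
  ultimately show ?thesis by blast
qed

end
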